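(* Let $K/F$ be a cyclic Galois field extension of degree $n$ with ${\rm Gal}(K/F)=\langle\sigma\rangle$, let $R=K[t;\sigma]$ and $x=t^n$, and let $N$ be the reduced norm of the central simple $F(x)$-algebra $K(t;\sigma)$. Let $f\in R$. If $N(f)$ is irreducible in $F[x]$, then $f$ is irreducible in $R$.
   Context: $K[t;\sigma]$ is the skew polynomial ring of polynomials $\sum a_it^i$, $a_i\in K$, with $ta=\sigma(a)t$ for $a\in K$. Its center is $F[x]$, $x=t^n$. The ring of central quotients $K(t;\sigma)=\{f/g : f\in R,\ 0\neq g\in F[x]\}$ is a central simple algebra of degree $n$ over $F(x)$ (the cyclic algebra $\bigoplus_{i=0}^{n-1}K(x)t^i$, $t^n=x$), and $N$ is its reduced norm; for $f\in R$ one has $N(f)\in F[x]$. An element of $R$ is irreducible if it is not a unit and is not a product $gh$ with $g,h\in R$ and $1\le\deg g,\deg h<\deg f$. *)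

theory Defs
  imports
    "Jordan_Normal_Form.Determinant"
    "HOL-Algebra.Embedded_Algebras"
    "HOL-Computational_Algebra.Normalized_Fraction"
begin

hide_const (open) up_ring.coeff up_ring.monom

section \<open>Cyclic Galois extensions\<close>

text \<open>A field extension is given by a homomorphism of fields \<open>\<iota> : F \<rightarrow> K\<close>.\<close>

definition galois_group :: "('f::field \<Rightarrow> 'k::field) \<Rightarrow> ('k \<Rightarrow> 'k) set" where
  "galois_group \<iota> = {\<tau>. field_hom \<tau> \<and> bij \<tau> \<and> (\<forall>a. \<tau> (\<iota> a) = \<iota> a)}"

text \<open>
  The constant \<open>vector_space.dim\<close> is 0 for infinite-dimensional spaces, so \<open>0 < n\<close> makes the
  extension finite. A finite extension is Galois if \<open>F\<close> is the fixed field of its group of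
  automorphisms. As this group is finite, it is generated by \<open>\<sigma>\<close> iff it consists of the powers
  of \<open>\<sigma>\<close> with exponent in the natural numbers.
\<close>

definition cyclic_galois :: "('f::field \<Rightarrow> 'k::field) \<Rightarrow> nat \<Rightarrow> ('k \<Rightarrow> 'k) \<Rightarrow> bool" where
  "cyclic_galois \<iota> n \<sigma> \<longleftrightarrow>
     field_hom \<iota> \<and>
     0 < n \<and> vector_space.dim (\<lambda>a v. \<iota> a * v) UNIV = n \<and>
     {v. \<forall>\<tau>\<in>galois_group \<iota>. \<tau> v = v} = range \<iota> \<and>
     galois_group \<iota> = {\<sigma> ^^ i | i. True}"


section \<open>The skew polynomial ring\<close>

text \<open>
  The polynomial with coefficients \<open>a\<^sub>i\<close> stands for the sum of the \<open>a\<^sub>i t\<^sup>i\<close>, coefficients on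
  the left; addition and degree are those of ordinary polynomials.
\<close>

definition skew_mult :: "('k::field \<Rightarrow> 'k) \<Rightarrow> 'k poly \<Rightarrow> 'k poly \<Rightarrow> 'k poly" where
  "skew_mult \<sigma> f g =
     (\<Sum>i\<le>degree f. \<Sum>j\<le>degree g. monom (coeff f i * (\<sigma> ^^ i) (coeff g j)) (i + j))"

lemma skew_mult_t_const: "skew_mult \<sigma> (monom 1 1) [:a:] = skew_mult \<sigma> [:\<sigma> a:] (monom 1 1)"
  if "\<sigma> 0 = 0"
  using that by (simp add: skew_mult_def degree_monom_eq atMost_Suc)

definition skew_ring :: "('k::field \<Rightarrow> 'k) \<Rightarrow> 'k poly ring" where
  "skew_ring \<sigma> = \<lparr>carrier = UNIV, mult = skew_mult \<sigma>, one = 1, zero = 0, add = (+)\<rparr>"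

definition skew_irreducible :: "('k::field \<Rightarrow> 'k) \<Rightarrow> 'k poly \<Rightarrow> bool" where
  "skew_irreducible \<sigma> f \<longleftrightarrow>
     f \<notin> Units (skew_ring \<sigma>) \<and>
     \<not> (\<exists>g h. f = skew_mult \<sigma> g h \<and>
          1 \<le> degree g \<and> degree g < degree f \<and> 1 \<le> degree h \<and> degree h < degree f)"

text \<open>The embedding of \<open>F[x]\<close> into the skew polynomial ring that sends \<open>x\<close> to \<open>t\<^sup>n\<close>.\<close>

definition center_poly :: "('f::field \<Rightarrow> 'k::field) \<Rightarrow> nat \<Rightarrow> 'f poly \<Rightarrow> 'k poly" where
  "center_poly \<iota> n p = pcompose (map_poly \<iota> p) (monom 1 n)"


section \<open>Rings of central quotients\<close>

text \<open>
  Fractions \<open>f/g\<close> with \<open>f\<close> in \<open>R\<close> and denominator \<open>g\<close> in \<open>S\<close>, where \<open>S\<close> is meant to be a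
  multiplicatively closed set of central elements that are not zero divisors.
\<close>

definition quot_rel :: "('a, 'm) ring_scheme \<Rightarrow> 'a set \<Rightarrow> (('a \<times> 'a) \<times> ('a \<times> 'a)) set" where
  "quot_rel R S = {((f, g), (f', g')).
     f \<in> carrier R \<and> f' \<in> carrier R \<and> g \<in> S \<and> g' \<in> S \<and> f \<otimes>\<^bsub>R\<^esub> g' = f' \<otimes>\<^bsub>R\<^esub> g}"

definition quot :: "('a, 'm) ring_scheme \<Rightarrow> 'a set \<Rightarrow> 'a \<Rightarrow> 'a \<Rightarrow> ('a \<times> 'a) set" where
  "quot R S f g = quot_rel R S `` {(f, g)}"

definition quot_ring :: "('a, 'm) ring_scheme \<Rightarrow> 'a set \<Rightarrow> ('a \<times> 'a) set ring" where
  "quot_ring R S =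
     \<lparr>carrier = (carrier R \<times> S) // quot_rel R S,
      mult = (\<lambda>X Y. \<Union>(f, g)\<in>X. \<Union>(f', g')\<in>Y. quot R S (f \<otimes>\<^bsub>R\<^esub> f') (g \<otimes>\<^bsub>R\<^esub> g')),
      one = quot R S \<one>\<^bsub>R\<^esub> \<one>\<^bsub>R\<^esub>,
      zero = quot R S \<zero>\<^bsub>R\<^esub> \<one>\<^bsub>R\<^esub>,
      add = (\<lambda>X Y. \<Union>(f, g)\<in>X. \<Union>(f', g')\<in>Y.
               quot R S (f \<otimes>\<^bsub>R\<^esub> g' \<oplus>\<^bsub>R\<^esub> f' \<otimes>\<^bsub>R\<^esub> g) (g \<otimes>\<^bsub>R\<^esub> g'))\<rparr>"


section \<open>Reduced norms\<close>

text \<open>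
  Let \<open>A\<close> be a central simple algebra of degree \<open>n\<close> over the field \<open>'e\<close>, with structure map
  \<open>e : 'e \<rightarrow> A\<close>, and let \<open>\<epsilon> : 'e \<rightarrow> 'l\<close> be a field extension. An isomorphism of \<open>'l\<close>-algebras
  between the scalar extension of \<open>A\<close> to \<open>'l\<close> and the algebra of \<open>n \<times> n\<close> matrices over \<open>'l\<close>
  amounts to a homomorphism \<open>\<phi>\<close> of \<open>'e\<close>-algebras from \<open>A\<close> to the matrices that sends an
  \<open>'e\<close>-basis of \<open>A\<close> to an \<open>'l\<close>-basis of the matrix algebra.
\<close>

definition algebra_basis :: "('a, 'm) ring_scheme \<Rightarrow> 'a set \<Rightarrow> 'a list \<Rightarrow> bool" where
  "algebra_basis A E us \<longleftrightarrow>
     set us \<subseteq> carrier A \<and> ring.independent A E us \<and> ring.Span A E us = carrier A"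

definition splitting ::
    "('a, 'm) ring_scheme \<Rightarrow> ('e::field \<Rightarrow> 'a) \<Rightarrow> ('e \<Rightarrow> 'l::field) \<Rightarrow> nat \<Rightarrow> ('a \<Rightarrow> 'l mat) \<Rightarrow> bool" where
  "splitting A e \<epsilon> n \<phi> \<longleftrightarrow>
     \<phi> \<in> Ring.ring_hom A (ring_mat TYPE('l) n ()) \<and>
     (\<forall>c. \<phi> (e c) = \<epsilon> c \<cdot>\<^sub>m 1\<^sub>m n) \<and>
     (\<exists>us. algebra_basis A (range e) us \<and>
        algebra_basis (ring_mat TYPE('l) n ()) (range (\<lambda>l. l \<cdot>\<^sub>m 1\<^sub>m n)) (map \<phi> us))"

text \<open>
  The reduced norm of \<open>a\<close>, computed by means of the splitting field \<open>'l\<close>. The value does not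
  depend on the splitting by the Skolem--Noether theorem.
\<close>

definition reduced_norm ::
    "('a, 'm) ring_scheme \<Rightarrow> ('e::field \<Rightarrow> 'a) \<Rightarrow> ('e \<Rightarrow> 'l::field) \<Rightarrow> nat \<Rightarrow> 'a \<Rightarrow> 'e" where
  "reduced_norm A e \<epsilon> n a = (THE c. \<exists>\<phi>. splitting A e \<epsilon> n \<phi> \<and> det (\<phi> a) = \<epsilon> c)"


section \<open>The algebra of central quotients of the skew polynomial ring\<close>

text \<open>Evaluates a function of numerator and denominator that respects equality of fractions.\<close>

definition fract_lift :: "('a::idom \<Rightarrow> 'a \<Rightarrow> 'b) \<Rightarrow> 'a fract \<Rightarrow> 'b" where
  "fract_lift h q = (THE r. \<exists>a b. b \<noteq> 0 \<and> q = Fract a b \<and> r = h a b)"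

definition center_denoms :: "('f::field \<Rightarrow> 'k::field) \<Rightarrow> nat \<Rightarrow> 'k poly set" where
  "center_denoms \<iota> n = center_poly \<iota> n ` (UNIV - {0})"

definition skew_quot ::
    "('f::field \<Rightarrow> 'k::field) \<Rightarrow> nat \<Rightarrow> ('k \<Rightarrow> 'k) \<Rightarrow> 'k poly \<Rightarrow> 'k poly \<Rightarrow> ('k poly \<times> 'k poly) set" where
  "skew_quot \<iota> n \<sigma> = quot (skew_ring \<sigma>) (center_denoms \<iota> n)"

definition skew_quot_ring ::
    "('f::field \<Rightarrow> 'k::field) \<Rightarrow> nat \<Rightarrow> ('k \<Rightarrow> 'k) \<Rightarrow> ('k poly \<times> 'k poly) set ring" where
  "skew_quot_ring \<iota> n \<sigma> = quot_ring (skew_ring \<sigma>) (center_denoms \<iota> n)"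

text \<open>The embedding of \<open>F(x)\<close> as the centre, and its embedding into \<open>K(x)\<close>.\<close>

definition center_fract ::
    "('f::field \<Rightarrow> 'k::field) \<Rightarrow> nat \<Rightarrow> ('k \<Rightarrow> 'k) \<Rightarrow> 'f poly fract \<Rightarrow> ('k poly \<times> 'k poly) set" where
  "center_fract \<iota> n \<sigma> =
     fract_lift (\<lambda>p q. skew_quot \<iota> n \<sigma> (center_poly \<iota> n p) (center_poly \<iota> n q))"

definition map_ratfun :: "('f::field \<Rightarrow> 'k::field) \<Rightarrow> 'f poly fract \<Rightarrow> 'k poly fract" where
  "map_ratfun \<iota> = fract_lift (\<lambda>p q. Fract (map_poly \<iota> p) (map_poly \<iota> q))"

text \<open>
  The reduced norm of the algebra of central quotients over its centre \<open>F(x)\<close>. As splitting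
  field serves \<open>K(x)\<close>, a maximal subfield of this cyclic algebra.
\<close>

definition skew_norm ::
    "('f::field \<Rightarrow> 'k::field) \<Rightarrow> nat \<Rightarrow> ('k \<Rightarrow> 'k) \<Rightarrow> ('k poly \<times> 'k poly) set \<Rightarrow> 'f poly fract" where
  "skew_norm \<iota> n \<sigma> =
     reduced_norm (skew_quot_ring \<iota> n \<sigma>) (center_fract \<iota> n \<sigma>) (map_ratfun \<iota>) n"

end

theory Submission
  imports Defs "Jordan_Normal_Form.VS_Connect" "Subresultants.More_Homomorphisms"
begin

text \<open>
  Write \<open>t\<^sup>i f\<close> for \<open>i < n\<close> in the basis \<open>1, t, \<dots>, t\<^sup>n\<^sup>-\<^sup>1\<close> of \<open>R\<close> over \<open>K[x]\<close>; the resulting matrix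
  \<open>M(f)\<close> over \<open>K[x]\<close> is multiplicative in \<open>f\<close>, and over \<open>K(x)\<close> it splits the algebra of central
  quotients. Hence \<open>N(f) = det M(f)\<close>, once this determinant is known not to depend on the splitting.
  Conjugating by \<open>M(t)\<close> shows \<open>det M(f) \<in> F[x]\<close>. If \<open>f = g h\<close> and \<open>N(f)\<close> is irreducible, then
  \<open>det M(g)\<close> or \<open>det M(h)\<close> is a unit. The adjugate then makes \<open>g\<close> or \<open>h\<close> a unit of \<open>R\<close>, so its degree
  is 0. The same determinant shows that \<open>f\<close> is not a unit.

  Skolem--Noether is only needed for representations of \<open>R\<close> that are scalar on the centre: such a
  representation contains an eigenvector \<open>v\<close> for the identity character of \<open>K\<close>, and in the basis
  \<open>v, v t, \<dots>, v t\<^sup>n\<^sup>-\<^sup>1\<close> it becomes \<open>M\<close>.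
\<close>

section \<open>Rings, fractions and bases\<close>

text \<open>The obstacle is the definite description in \<open>reduced_norm\<close>: it has a value
  only if a splitting exists and all splittings give the same determinant. Both halves come down to
  inverting the n by n matrix of conjugates \<sigma>^k(b_j) of an F-basis b of K. A second family c,
  dual to b for the trace, supplies the inverse in closed form. The coordinates of a matrix in the
  basis b_j t^i, the idempotents of K \<otimes> K and the independence of eigenvectors for distinct
  characters then become explicit sums over c. The hypothesis gives n as a dimension only; that
  \<sigma> has order n is obtained together with c. Coordinates are taken in a left module, so
  elements of R act on row vectors from the right. This is why M preserves the order of
  products.\<close>

lemma ring_of_embedding:
  fixes A (structure)
  assumes "ring B" and inj: "inj_on h (carrier A)"
    and h_carrier: "\<And>x. x \<in> carrier A \<Longrightarrow> h x \<in> carrier B"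
    and closed: "\<And>x y. x \<in> carrier A \<Longrightarrow> y \<in> carrier A \<Longrightarrow> x \<otimes> y \<in> carrier A"
      "\<And>x y. x \<in> carrier A \<Longrightarrow> y \<in> carrier A \<Longrightarrow> x \<oplus> y \<in> carrier A"
      "\<one> \<in> carrier A" "\<zero> \<in> carrier A"
    and hom: "\<And>x y. x \<in> carrier A \<Longrightarrow> y \<in> carrier A \<Longrightarrow> h (x \<otimes> y) = h x \<otimes>\<^bsub>B\<^esub> h y"
      "\<And>x y. x \<in> carrier A \<Longrightarrow> y \<in> carrier A \<Longrightarrow> h (x \<oplus> y) = h x \<oplus>\<^bsub>B\<^esub> h y"
      "h \<one> = \<one>\<^bsub>B\<^esub>" "h \<zero> = \<zero>\<^bsub>B\<^esub>"
    and neg: "\<And>x. x \<in> carrier A \<Longrightarrow> \<exists>y\<in>carrier A. h y = \<ominus>\<^bsub>B\<^esub> h x"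
  shows "ring A"
proof -
  interpret B: ring B by fact
  note eqI = inj_onD[OF inj]
  show ?thesis
  proof (rule ringI)
    show "abelian_group A"
    proof (rule abelian_groupI)
      fix x assume x: "x \<in> carrier A"
      then obtain y where "y \<in> carrier A" "h y = \<ominus>\<^bsub>B\<^esub> h x" using neg by blast
      then show "\<exists>y\<in>carrier A. y \<oplus> x = \<zero>"
        using x by (intro bexI[of _ y] eqI) (auto simp: closed hom h_carrier B.l_neg)
    qed (auto intro!: eqI simp: closed hom h_carrier B.a_ac)
    show "monoid A"
      by (rule monoidI) (auto intro!: eqI simp: closed hom h_carrier B.m_assoc)
  qed (auto intro!: eqI simp: closed hom h_carrier B.l_distr B.r_distr)
qed

text \<open>Sum and product in \<open>quot_ring\<close> are unions over all pairs of
  representatives. They collapse to one class as soon as the class does not depend on the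
  representatives.\<close>

lemma UN_pairs_const:
  assumes "p \<in> X" "p' \<in> Y"
    and "\<And>a d a' d'. (a, d) \<in> X \<Longrightarrow> (a', d') \<in> Y \<Longrightarrow> G a d a' d' = C"
  shows "(\<Union>(a, d)\<in>X. \<Union>(a', d')\<in>Y. G a d a' d') = C"
proof -
  have "(\<Union>(a, d)\<in>X. \<Union>(a', d')\<in>Y. G a d a' d') = (\<Union>_\<in>X. \<Union>_\<in>Y. C)"
    by (intro SUP_cong refl) (auto simp: assms(3))
  then show ?thesis using assms(1,2) by auto
qed

text \<open>The value \<open>\<psi> f g\<close> plays the role of f/g inside a known ring
  \<open>B\<close>. Since \<open>\<psi>_eq\<close> makes its fibres exactly the classes of
  \<open>quot_rel\<close>, the operations are well defined and every ring axiom of the quotients is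
  pulled back from \<open>B\<close>.\<close>

locale fraction_embedding = B: ring B for B :: "('b, 'n) ring_scheme" +
  fixes R :: "('a, 'm) ring_scheme" (structure) and S :: "'a set" and \<psi> :: "'a \<Rightarrow> 'a \<Rightarrow> 'b"
  assumes R_closed: "f \<in> carrier R \<Longrightarrow> f' \<in> carrier R \<Longrightarrow> f \<otimes> f' \<in> carrier R"
      "f \<in> carrier R \<Longrightarrow> f' \<in> carrier R \<Longrightarrow> f \<oplus> f' \<in> carrier R"
      "\<one> \<in> carrier R" "\<zero> \<in> carrier R"
    and S_closed: "S \<subseteq> carrier R" "g \<in> S \<Longrightarrow> g' \<in> S \<Longrightarrow> g \<otimes> g' \<in> S" "\<one> \<in> S"
    and \<psi>_carrier: "f \<in> carrier R \<Longrightarrow> g \<in> S \<Longrightarrow> \<psi> f g \<in> carrier B"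
    and \<psi>_eq: "f \<in> carrier R \<Longrightarrow> g \<in> S \<Longrightarrow> f' \<in> carrier R \<Longrightarrow> g' \<in> S \<Longrightarrow>
      \<psi> f g = \<psi> f' g' \<longleftrightarrow> f \<otimes> g' = f' \<otimes> g"
    and \<psi>_mult: "f \<in> carrier R \<Longrightarrow> g \<in> S \<Longrightarrow> f' \<in> carrier R \<Longrightarrow> g' \<in> S \<Longrightarrow>
      \<psi> (f \<otimes> f') (g \<otimes> g') = \<psi> f g \<otimes>\<^bsub>B\<^esub> \<psi> f' g'"
    and \<psi>_add: "f \<in> carrier R \<Longrightarrow> g \<in> S \<Longrightarrow> f' \<in> carrier R \<Longrightarrow> g' \<in> S \<Longrightarrow>
      \<psi> (f \<otimes> g' \<oplus> f' \<otimes> g) (g \<otimes> g') = \<psi> f g \<oplus>\<^bsub>B\<^esub> \<psi> f' g'"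
    and \<psi>_one: "\<psi> \<one> \<one> = \<one>\<^bsub>B\<^esub>"
    and \<psi>_zero: "\<psi> \<zero> \<one> = \<zero>\<^bsub>B\<^esub>"
    and \<psi>_neg: "f \<in> carrier R \<Longrightarrow> g \<in> S \<Longrightarrow> \<exists>f'\<in>carrier R. \<psi> f' g = \<ominus>\<^bsub>B\<^esub> \<psi> f g"
begin

abbreviation Q :: "('a \<times> 'a) set ring" where "Q \<equiv> quot_ring R S"

lemma quot_eq:
  assumes "f \<in> carrier R" "g \<in> S"
  shows "quot R S f g = {(f', g'). f' \<in> carrier R \<and> g' \<in> S \<and> \<psi> f' g' = \<psi> f g}"
  using assms by (auto simp: quot_def quot_rel_def \<psi>_eq)

lemma quot_eq_iff:
  assumes "f \<in> carrier R" "g \<in> S" "f' \<in> carrier R" "g' \<in> S"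
  shows "quot R S f g = quot R S f' g' \<longleftrightarrow> \<psi> f g = \<psi> f' g'"
  using assms by (auto simp: quot_eq)

lemma Q_carrier: "carrier Q = {quot R S f g | f g. f \<in> carrier R \<and> g \<in> S}"
  by (auto simp: quot_ring_def quot_def quotient_def)

lemma quot_carrier [simp]: "f \<in> carrier R \<Longrightarrow> g \<in> S \<Longrightarrow> quot R S f g \<in> carrier Q"
  by (auto simp: Q_carrier)

lemma Q_cases:
  assumes "X \<in> carrier Q"
  obtains f g where "f \<in> carrier R" "g \<in> S" "X = quot R S f g"
  using assms by (auto simp: Q_carrier)

lemma quot_mult:
  assumes "f \<in> carrier R" "g \<in> S" "f' \<in> carrier R" "g' \<in> S"
  shows "quot R S f g \<otimes>\<^bsub>Q\<^esub> quot R S f' g' = quot R S (f \<otimes> f') (g \<otimes> g')"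
proof -
  have "quot R S (a \<otimes> a') (d \<otimes> d') = quot R S (f \<otimes> f') (g \<otimes> g')"
    if "(a, d) \<in> quot R S f g" "(a', d') \<in> quot R S f' g'" for a d a' d'
    using that assms by (subst quot_eq_iff) (auto simp: quot_eq \<psi>_mult R_closed S_closed)
  moreover have "(f, g) \<in> quot R S f g" "(f', g') \<in> quot R S f' g'"
    using assms by (auto simp: quot_eq)
  ultimately show ?thesis
    unfolding quot_ring_def ring.simps monoid.simps by (intro UN_pairs_const)
qed

lemma quot_add:
  assumes "f \<in> carrier R" "g \<in> S" "f' \<in> carrier R" "g' \<in> S"
  shows "quot R S f g \<oplus>\<^bsub>Q\<^esub> quot R S f' g' = quot R S (f \<otimes> g' \<oplus> f' \<otimes> g) (g \<otimes> g')"
proof -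
  note S = subsetD[OF S_closed(1)]
  have "quot R S (a \<otimes> d' \<oplus> a' \<otimes> d) (d \<otimes> d') = quot R S (f \<otimes> g' \<oplus> f' \<otimes> g) (g \<otimes> g')"
    if "(a, d) \<in> quot R S f g" "(a', d') \<in> quot R S f' g'" for a d a' d'
    using that assms by (subst quot_eq_iff) (auto simp: quot_eq \<psi>_add R_closed S_closed(2,3) S)
  moreover have "(f, g) \<in> quot R S f g" "(f', g') \<in> quot R S f' g'"
    using assms by (auto simp: quot_eq)
  ultimately show ?thesis
    unfolding quot_ring_def ring.simps monoid.simps by (intro UN_pairs_const)
qed

lemma Q_one: "\<one>\<^bsub>Q\<^esub> = quot R S \<one> \<one>" and Q_zero: "\<zero>\<^bsub>Q\<^esub> = quot R S \<zero> \<one>"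
  by (simp_all add: quot_ring_def)

text \<open>The map \<open>\<psi>\<close> is constant on each class, so the image of a class is a
  singleton.\<close>

definition Psi :: "('a \<times> 'a) set \<Rightarrow> 'b" where
  "Psi X = the_elem (case_prod \<psi> ` X)"

lemma Psi_quot [simp]:
  assumes "f \<in> carrier R" "g \<in> S"
  shows "Psi (quot R S f g) = \<psi> f g"
proof -
  have "case_prod \<psi> ` quot R S f g = {\<psi> f g}" using assms by (force simp: quot_eq)
  then show ?thesis by (simp add: Psi_def)
qed

lemma Psi_hom_props:
  "x \<in> carrier Q \<Longrightarrow> Psi x \<in> carrier B"
  "x \<in> carrier Q \<Longrightarrow> y \<in> carrier Q \<Longrightarrow> x \<otimes>\<^bsub>Q\<^esub> y \<in> carrier Q"
  "x \<in> carrier Q \<Longrightarrow> y \<in> carrier Q \<Longrightarrow> x \<oplus>\<^bsub>Q\<^esub> y \<in> carrier Q"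
  "x \<in> carrier Q \<Longrightarrow> y \<in> carrier Q \<Longrightarrow> Psi (x \<otimes>\<^bsub>Q\<^esub> y) = Psi x \<otimes>\<^bsub>B\<^esub> Psi y"
  "x \<in> carrier Q \<Longrightarrow> y \<in> carrier Q \<Longrightarrow> Psi (x \<oplus>\<^bsub>Q\<^esub> y) = Psi x \<oplus>\<^bsub>B\<^esub> Psi y"
  "Psi \<one>\<^bsub>Q\<^esub> = \<one>\<^bsub>B\<^esub>" "Psi \<zero>\<^bsub>Q\<^esub> = \<zero>\<^bsub>B\<^esub>"
  using subsetD[OF S_closed(1)]
  by (auto elim!: Q_cases simp: quot_mult quot_add Q_one Q_zero
      R_closed S_closed(2,3) \<psi>_carrier \<psi>_mult \<psi>_add \<psi>_one \<psi>_zero)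

lemma Psi_inj: "inj_on Psi (carrier Q)"
proof (rule inj_onI)
  fix X Y assume "X \<in> carrier Q" "Y \<in> carrier Q" "Psi X = Psi Y"
  then show "X = Y" by (elim Q_cases) (simp add: quot_eq_iff)
qed

lemma ring_Q: "ring Q"
proof (rule ring_of_embedding[OF B.ring_axioms Psi_inj])
  fix x assume "x \<in> carrier Q"
  then obtain f g where fg: "f \<in> carrier R" "g \<in> S" "x = quot R S f g" by (rule Q_cases)
  with \<psi>_neg obtain f' where "f' \<in> carrier R" "\<psi> f' g = \<ominus>\<^bsub>B\<^esub> \<psi> f g" by blast
  with fg show "\<exists>y\<in>carrier Q. Psi y = \<ominus>\<^bsub>B\<^esub> Psi x"
    by (intro bexI[of _ "quot R S f' g"]) auto
next
  show "\<one>\<^bsub>Q\<^esub> \<in> carrier Q" "\<zero>\<^bsub>Q\<^esub> \<in> carrier Q"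
    by (simp_all add: Q_one Q_zero R_closed S_closed)
qed (auto simp: Psi_hom_props)

lemma Psi_hom: "ring_hom_ring Q B Psi"
  using ring_Q B.ring_axioms by (rule ring_hom_ringI) (auto simp: Psi_hom_props)

end

text \<open>Bridges two views of scalars: the base field is a type with a structure map, whereas
  \<open>algebra_basis\<close> expects a subfield that is a subset of the ring.\<close>

lemma (in ring) subfield_range:
  fixes e :: "'e::field \<Rightarrow> 'a"
  assumes "\<And>c. e c \<in> carrier R" "\<And>c d. e (c + d) = e c \<oplus> e d" "\<And>c d. e (c * d) = e c \<otimes> e d"
    and "e 1 = \<one>" "\<one> \<noteq> \<zero>"
  shows "subfield (range e) R"
proof -
  let ?E = "class_ring :: 'e ring"
  interpret e: ring_hom_ring ?E R e
    by (rule ring_hom_ringI[OF class_ring.ring_axioms ring_axioms]) (use assms in auto)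
  show ?thesis
    using e.img_is_subfield(2)[OF field.carrier_is_subfield[OF class_field] assms(5)] by simp
qed

lemma (in ring) algebra_basisI:
  assumes E: "subfield E R" and us: "set us \<subseteq> carrier R"
    and indep: "\<And>ks. set ks \<subseteq> E \<Longrightarrow> length ks = length us \<Longrightarrow> combine ks us = \<zero> \<Longrightarrow> set ks \<subseteq> {\<zero>}"
    and span: "\<And>x. x \<in> carrier R \<Longrightarrow> \<exists>ks. set ks \<subseteq> E \<and> combine ks us = x"
  shows "algebra_basis R E us"
proof -
  have "independent E us"
  proof (rule ccontr)
    assume "\<not> independent E us"
    from dependent_imp_non_trivial_combine[OF E us this] obtain ks
      where ks: "length ks = length us" "combine ks us = \<zero>" "set ks \<subseteq> E" "set ks \<noteq> {\<zero>}" .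
    \<comment> \<open>The condition \<open>set ks \<noteq> {\<zero>}\<close> also holds for the
      empty list, so this case survives. It forces \<open>us\<close> to be empty, and the empty list
      is independent.\<close>
    then have "ks = []" using indep[of ks] by (cases ks) auto
    with ks have "us = []" by simp
    with \<open>\<not> independent E us\<close> show False by simp
  qed
  moreover have "Span E us = carrier R"
    using Span_in_carrier[OF subfieldE(3)[OF E] us] span
    unfolding Span_eq_combine_set[OF E us] by blast
  ultimately show ?thesis using us by (simp add: algebra_basis_def)
qed

lemma combine_scalar_mat:
  fixes ls :: "'l::field list"
  assumes "length ls = length Us" "set Us \<subseteq> carrier_mat n n" "i < n" "j < n"
  shows "ring.combine (ring_mat TYPE('l) n ()) (map (\<lambda>l. l \<cdot>\<^sub>m 1\<^sub>m n) ls) Us \<in> carrier_mat n n"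
    and "ring.combine (ring_mat TYPE('l) n ()) (map (\<lambda>l. l \<cdot>\<^sub>m 1\<^sub>m n) ls) Us $$ (i, j) =
      (\<Sum>r<length Us. ls ! r * (Us ! r) $$ (i, j))"
proof -
  interpret M: ring "ring_mat TYPE('l) n ()" by (rule ring_mat)
  have "M.combine (map (\<lambda>l. l \<cdot>\<^sub>m 1\<^sub>m n) ls) Us \<in> carrier_mat n n \<and>
     M.combine (map (\<lambda>l. l \<cdot>\<^sub>m 1\<^sub>m n) ls) Us $$ (i, j) =
      (\<Sum>r<length Us. ls ! r * (Us ! r) $$ (i, j))"
    using assms(1,2)
  proof (induction ls Us rule: list_induct2)
    case Nil
    then show ?case using assms(3,4) by (simp add: ring_mat_simps)
  next
    case (Cons l ls U Us)
    have "(l \<cdot>\<^sub>m 1\<^sub>m n) * U = l \<cdot>\<^sub>m U"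
      using Cons.prems by (simp add: mult_smult_assoc_mat[of _ n n _ n] left_mult_one_mat[of _ n n])
    with Cons assms(3,4) show ?case
      by (auto simp: ring_mat_simps sum.lessThan_Suc_shift simp del: sum.lessThan_Suc)
  qed
  then show "M.combine (map (\<lambda>l. l \<cdot>\<^sub>m 1\<^sub>m n) ls) Us \<in> carrier_mat n n"
    "M.combine (map (\<lambda>l. l \<cdot>\<^sub>m 1\<^sub>m n) ls) Us $$ (i, j) = (\<Sum>r<length Us. ls ! r * (Us ! r) $$ (i, j))"
    by auto
qed

text \<open>Numbers below k m correspond to pairs of a remainder and a quotient modulo k. With k = n
  this passes between exponents of t and pairs (power of t below n, power of x).\<close>

lemma sum_nat_blocks: "(\<Sum>q<m. \<Sum>l<k. g (l + k * q)) = sum g {..<k * m :: nat}"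
  for g :: "nat \<Rightarrow> 'b::comm_monoid_add"
proof -
  have "(\<Sum>l<k. g (l + k * q)) = sum g {q * k..<q * k + k}" for q
    using sum.shift_bounds_nat_ivl[of g 0 "q * k" k]
    by (simp add: atLeast0LessThan algebra_simps)
  then show ?thesis by (simp add: sum.nat_group mult.commute)
qed

section \<open>The Galois group and dual bases\<close>

lemma field_hom_id: "field_hom (\<lambda>a :: 'k::field. a)"
  by unfold_locales auto

lemma funpow_mod_eq_of_id:
  assumes "f ^^ n = id"
  shows "f ^^ (k mod n) = f ^^ k"
proof -
  have "f ^^ k = f ^^ (k mod n + n * (k div n))" by simp
  also have "\<dots> = f ^^ (k mod n)"
    unfolding funpow_add funpow_mult[symmetric] assms by (simp add: id_def[symmetric])
  finally show ?thesis by simp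
qed

text \<open>
  The tensor \<open>z \<otimes> 1 - 1 \<otimes> z\<close> vanishes under \<open>x \<otimes> y \<mapsto> x y\<close> and not under \<open>x \<otimes> y \<mapsto> x \<tau>(y)\<close> if
  \<open>\<tau>\<close> moves \<open>z\<close>. The factor for \<open>\<tau>\<close> is the normalized \<open>1 \<otimes> z - \<tau>(z) \<otimes> 1\<close>, which has the roles exchanged.
\<close>

lemma separating_tensor:
  fixes S :: "('k::field \<Rightarrow> 'k) set"
  assumes "finite S" and "\<And>\<tau>. \<tau> \<in> S \<Longrightarrow> field_hom \<tau> \<and> \<tau> \<noteq> id"
  shows "\<exists>xs. (\<Sum>(x, y)\<leftarrow>xs. x * y) = 1 \<and> (\<forall>\<tau>\<in>S. (\<Sum>(x, y)\<leftarrow>xs. x * \<tau> y) = 0)"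
  using assms
proof (induction S rule: finite_induct)
  case empty
  show ?case by (rule exI[of _ "[(1, 1)]"]) simp
next
  case (insert \<rho> S)
  then obtain xs where xs: "(\<Sum>(x, y)\<leftarrow>xs. x * y) = 1" "\<And>\<tau>. \<tau> \<in> S \<Longrightarrow> (\<Sum>(x, y)\<leftarrow>xs. x * \<tau> y) = 0"
    by blast
  from insert.prems[of \<rho>] obtain z where z: "\<rho> z \<noteq> z" by (auto simp: fun_eq_iff)
  define d where "d = z - \<rho> z"
  have d: "d \<noteq> 0" using z by (simp add: d_def)
  \<comment> \<open>The factor \<open>u + v * \<tau> z\<close> equals (\<tau>(z) - \<rho>(z)) / d,
    which is 1 for the identity and 0 for \<rho>. The list \<open>ys\<close> is the product of
    \<open>xs\<close> with u \<otimes> 1 + v \<otimes> z.\<close>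
  define u v where "u = - \<rho> z / d" and "v = 1 / d"
  define ys where "ys = map (\<lambda>(x, y). (x * u, y)) xs @ map (\<lambda>(x, y). (x * v, y * z)) xs"
  have fact: "(\<Sum>(x, y)\<leftarrow>ys. x * \<tau> y) = (\<Sum>(x, y)\<leftarrow>xs. x * \<tau> y) * (u + v * \<tau> z)"
    if "field_hom \<tau>" for \<tau>
  proof -
    interpret t: field_hom \<tau> by fact
    have "(\<Sum>(x, y)\<leftarrow>map (\<lambda>(x, y). (x * u, y)) xs @ map (\<lambda>(x, y). (x * v, y * z)) xs. x * \<tau> y)
        = (\<Sum>(x, y)\<leftarrow>xs. x * \<tau> y) * (u + v * \<tau> z)"
      by (induction xs) (auto simp: hom_distribs algebra_simps)
    then show ?thesis by (simp add: ys_def)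
  qed
  have "(\<Sum>(x, y)\<leftarrow>ys. x * y) = 1"
    using fact[OF field_hom_id] xs(1) d by (simp add: u_def v_def divide_simps) (simp add: d_def)
  moreover have "(\<Sum>(x, y)\<leftarrow>ys. x * \<tau> y) = 0" if t: "\<tau> \<in> insert \<rho> S" for \<tau>
  proof (cases "\<tau> = \<rho>")
    case True
    have "u + v * \<rho> z = 0" by (simp add: u_def v_def)
    with fact[of \<tau>] insert.prems[OF t] True show ?thesis by simp
  next
    case False
    with fact[of \<tau>] insert.prems[OF t] xs(2)[of \<tau>] t show ?thesis by simp
  qed
  ultimately show ?case by blast
qed

text \<open>If m < n, pad both rectangular matrices with zeros to size n. The product is still the
  identity, but the last column of the padded left factor vanishes, so its determinant is 0.\<close>

lemma one_sided_inverse_dim_le: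
  fixes a b :: "nat \<Rightarrow> nat \<Rightarrow> 'k::field"
  assumes "\<And>i j. i < n \<Longrightarrow> j < n \<Longrightarrow> (\<Sum>k<m. a i k * b k j) = (if i = j then 1 else 0)"
  shows "n \<le> m"
proof (rule ccontr)
  assume "\<not> n \<le> m"
  then have mn: "m < n" by simp
  define A where "A = mat n n (\<lambda>(i, k). if k < m then a i k else 0)"
  define B where "B = mat n n (\<lambda>(k, j). if k < m then b k j else 0)"
  have AB: "A * B = 1\<^sub>m n"
  proof (rule eq_matI)
    fix i j assume ij: "i < dim_row (1\<^sub>m n)" "j < dim_col (1\<^sub>m n)"
    have "(A * B) $$ (i, j) = (\<Sum>k = 0..<n. if k < m then a i k * b k j else 0)"
      using ij by (auto simp: A_def B_def scalar_prod_def intro!: sum.cong)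
    also have "\<dots> = (\<Sum>k<m. a i k * b k j)"
      using mn by (intro sum.mono_neutral_cong_right) auto
    finally show "(A * B) $$ (i, j) = 1\<^sub>m n $$ (i, j)" using assms ij by auto
  qed (auto simp: A_def B_def)
  have "A *\<^sub>v unit_vec n (n - 1) = 0\<^sub>v n"
    using mn by (intro eq_vecI) (auto simp: A_def)
  moreover have "unit_vec n (n - 1) \<noteq> (0\<^sub>v n :: 'k vec)"
    using mn by (metis diff_less index_unit_vec(1) index_zero_vec(1) less_nat_zero_code
        not_gr_zero zero_less_one zero_neq_one)
  moreover have "A \<in> carrier_mat n n" by (simp add: A_def)
  ultimately have "det A = 0"
    using det_0_iff_vec_prod_zero_field[of A n] unit_vec_carrier[of n "n - 1"] by blast
  moreover have "det A * det B = 1"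
    using det_mult[of A n B] AB by (simp add: A_def B_def)
  ultimately show False by simp
qed

locale cyclic_ext =
  fixes \<iota> :: "'f::field \<Rightarrow> 'k::field" and n :: nat and \<sigma> :: "'k \<Rightarrow> 'k"
  assumes cyclic: "cyclic_galois \<iota> n \<sigma>"
begin

sublocale \<iota>: field_hom \<iota>
  using cyclic by (simp add: cyclic_galois_def)

lemma n_pos: "0 < n"
  using cyclic by (simp add: cyclic_galois_def)

lemma funpow_in_galois_group: "\<sigma> ^^ i \<in> galois_group \<iota>"
  using cyclic by (auto simp: cyclic_galois_def)

sublocale \<sigma>: field_hom \<sigma>
  using funpow_in_galois_group[of 1] by (simp add: galois_group_def)

sublocale funpow: field_hom "\<sigma> ^^ i" for i
  using funpow_in_galois_group[of i] by (simp add: galois_group_def)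

lemma funpow_\<iota> [simp]: "(\<sigma> ^^ i) (\<iota> a) = \<iota> a"
  using funpow_in_galois_group[of i] by (simp add: galois_group_def)

lemma \<sigma>_\<iota> [simp]: "\<sigma> (\<iota> a) = \<iota> a"
  using funpow_\<iota>[of 1] by simp

lemma fixed_imp_range:
  assumes "\<sigma> v = v"
  shows "v \<in> range \<iota>"
proof -
  have "(\<sigma> ^^ i) v = v" for i by (induction i) (use assms in auto)
  moreover have "galois_group \<iota> = {\<sigma> ^^ i | i. True}"
    using cyclic by (simp add: cyclic_galois_def)
  ultimately have "v \<in> {v. \<forall>\<tau>\<in>galois_group \<iota>. \<tau> v = v}" by auto
  also have "\<dots> = range \<iota>" using cyclic unfolding cyclic_galois_def by (elim conjE)
  finally show ?thesis .
qed

text \<open>The inverse of \<sigma> is again an F-automorphism, hence a power of \<sigma> with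
  natural exponent i, and then \<sigma>^(i+1) is the identity.\<close>

lemma finite_order: "\<exists>m>0. \<sigma> ^^ m = id"
proof -
  have b: "bij \<sigma>" using funpow_in_galois_group[of 1] by (simp add: galois_group_def)
  then have r: "\<sigma> (inv_into UNIV \<sigma> a) = a" for a by (simp add: bij_is_surj surj_f_inv_f)
  have "field_hom (inv_into UNIV \<sigma>)"
    by unfold_locales (rule \<sigma>.injectivity; simp add: hom_distribs r)+
  moreover have "inv_into UNIV \<sigma> (\<iota> a) = \<iota> a" for a
    by (rule \<sigma>.injectivity) (simp add: r)
  ultimately have "inv_into UNIV \<sigma> \<in> galois_group \<iota>" using b by (simp add: galois_group_def bij_imp_bij_inv)
  then obtain i where "inv_into UNIV \<sigma> = \<sigma> ^^ i" using cyclic by (auto simp: cyclic_galois_def)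
  then have "\<sigma> ^^ Suc i = id" using r by (auto simp: fun_eq_iff)
  then show ?thesis by blast
qed

lemma basis:
  "\<exists>b. (\<forall>a. \<exists>r. a = (\<Sum>j<n. \<iota> (r j) * b j)) \<and>
       (\<forall>r. (\<Sum>j<n. \<iota> (r j) * b j) = 0 \<longrightarrow> (\<forall>j<n. r j = 0))"
proof -
  interpret V: vector_space "\<lambda>a v. \<iota> a * v"
    by unfold_locales (auto simp: hom_distribs algebra_simps)
  obtain B where B: "V.independent B" "UNIV \<subseteq> V.span B" "card B = V.dim UNIV"
    using V.basis_exists[of UNIV] by blast
  have card: "card B = n" using B(3) cyclic by (simp add: cyclic_galois_def)
  \<comment> \<open>An infinite set has \<open>card\<close> 0, so positivity of \<open>n\<close>
    yields finiteness.\<close>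
  then have fin: "finite B" using n_pos by (intro card_ge_0_finite) simp
  obtain b where b: "bij_betw b {..<n} B"
    using ex_bij_betw_nat_finite[OF fin] card by (auto simp: atLeast0LessThan)
  have sum_B: "(\<Sum>v\<in>B. g v) = (\<Sum>j<n. g (b j))" for g :: "'k \<Rightarrow> 'k"
    using sum.reindex_bij_betw[OF b, of g] by (rule sym)
  show ?thesis
  proof (intro exI[of _ b] conjI allI impI)
    fix a
    have "a \<in> V.span B" using B(2) by blast
    then obtain u where "a = (\<Sum>v\<in>B. \<iota> (u v) * v)"
      unfolding V.span_finite[OF fin] by (rule imageE)
    then show "\<exists>r. a = (\<Sum>j<n. \<iota> (r j) * b j)"
      unfolding sum_B by (intro exI[of _ "\<lambda>j. u (b j)"])
  next
    fix r assume r: "(\<Sum>j<n. \<iota> (r j) * b j) = 0"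
    let ?g = "r \<circ> the_inv_into {..<n} b"
    have inv: "the_inv_into {..<n} b (b j) = j" if "j < n" for j
      using b that by (simp add: bij_betw_def the_inv_into_f_f)
    have "(\<Sum>v\<in>B. \<iota> (?g v) * v) = 0" unfolding sum_B using r inv by simp
    then have g: "?g v = 0" if "v \<in> B" for v
      by (rule V.independentD[OF B(1) fin subset_refl _ that])
    fix j assume j: "j < n"
    have "b j \<in> B" using b j by (auto simp: bij_betw_def)
    from g[OF this] inv[OF j] show "r j = 0" by simp
  qed
qed

lemmas hom_simps = \<iota>.hom_mult \<iota>.hom_sum \<iota>.hom_add \<iota>.hom_minus \<sigma>.hom_mult \<sigma>.hom_sum \<sigma>.hom_add
  funpow.hom_mult funpow.hom_sum funpow.hom_add

text \<open>Let m be the order of \<sigma>. A separating tensor takes the value 1 at the identity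
  and 0 at the other m - 1 powers; written as the sum of the c_j \<otimes> b_j, it gives the first
  relation. The second compares the expansion of b_j with coordinates Tr(c_i b_j) with the obvious
  one. Thus an m by n and an n by m matrix of conjugates are inverse on both sides, whence m =
  n.\<close>

theorem dual_bases:
  shows "\<sigma> ^^ n = id"
    and "\<exists>b c. (\<forall>i<n. \<forall>k<n. (\<Sum>j<n. (\<sigma> ^^ i) (c j) * (\<sigma> ^^ k) (b j)) = (if i = k then 1 else 0)) \<and>
               (\<forall>i<n. \<forall>j<n. (\<Sum>k<n. (\<sigma> ^^ k) (c i) * (\<sigma> ^^ k) (b j)) = (if i = j then 1 else 0))"
proof -
  define m where "m = (LEAST m. 0 < m \<and> \<sigma> ^^ m = id)"
  have m: "0 < m" "\<sigma> ^^ m = id"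
    using LeastI_ex[OF finite_order] by (auto simp: m_def)
  have m_min: "\<sigma> ^^ i \<noteq> id" if "0 < i" "i < m" for i
    using not_less_Least[of i "\<lambda>m. 0 < m \<and> \<sigma> ^^ m = id"] that by (auto simp: m_def)
  have pow_m: "(\<sigma> ^^ (m - k)) ((\<sigma> ^^ k) a) = a" "(\<sigma> ^^ k) ((\<sigma> ^^ (m - k)) a) = a" if "k \<le> m" for k a
    using that m(2) funpow_add[of "m - k" k \<sigma>] funpow_add[of k "m - k" \<sigma>] by (simp_all add: fun_eq_iff)
  define Tr where "Tr a = (\<Sum>k<m. (\<sigma> ^^ k) a)" for a
  have Tr_range: "Tr a \<in> range \<iota>" for a
  proof (rule fixed_imp_range)
    \<comment> \<open>The sum over the exponents 0 to m may drop its first or its last term; both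
      equal a because \<sigma>^m is the identity.\<close>
    have "\<sigma> (Tr a) + a = (\<Sum>k<Suc m. (\<sigma> ^^ k) a)"
      unfolding Tr_def by (subst sum.lessThan_Suc_shift) (simp add: hom_simps)
    also have "\<dots> = Tr a + a" using m by (simp add: Tr_def)
    finally show "\<sigma> (Tr a) = Tr a" by simp
  qed
  let ?S = "(\<lambda>i. \<sigma> ^^ i) ` {0<..<m}"
  have "field_hom \<tau> \<and> \<tau> \<noteq> id" if "\<tau> \<in> ?S" for \<tau>
    using that m_min funpow.field_hom_axioms by auto
  then have "\<exists>xs. (\<Sum>(x, y)\<leftarrow>xs. x * y) = 1 \<and> (\<forall>\<tau>\<in>?S. (\<Sum>(x, y)\<leftarrow>xs. x * \<tau> y) = 0)"
    by (intro separating_tensor) auto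
  then obtain xs where
    xs: "(\<Sum>(x, y)\<leftarrow>xs. x * y) = 1"
        "\<forall>\<tau>\<in>?S. (\<Sum>(x, y)\<leftarrow>xs. x * \<tau> y) = 0"
    by blast
  obtain b where
    b_span: "\<forall>a. \<exists>r. a = (\<Sum>j<n. \<iota> (r j) * b j)" and
    b_indep: "\<forall>r. (\<Sum>j<n. \<iota> (r j) * b j) = 0 \<longrightarrow> (\<forall>j<n. r j = 0)"
    using basis by (elim exE conjE)
  define coord where "coord a = (SOME r. a = (\<Sum>j<n. \<iota> (r j) * b j))" for a
  have coord: "a = (\<Sum>j<n. \<iota> (coord a j) * b j)" for a
    unfolding coord_def using someI_ex[OF spec[OF b_span]] .
  \<comment> \<open>Expand the right factors in the basis \<open>b\<close> and move the coordinates,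
    which lie in F, to the left: the tensor becomes the sum of the c_j \<otimes> b_j.\<close>
  define c where "c j = (\<Sum>(x, y)\<leftarrow>xs. x * \<iota> (coord y j))" for j
  have sum_cb: "(\<Sum>j<n. c j * (\<sigma> ^^ k) (b j)) = (\<Sum>(x, y)\<leftarrow>xs. x * (\<sigma> ^^ k) y)" for k
  proof -
    have *: "(\<sigma> ^^ k) y = (\<Sum>j<n. \<iota> (coord y j) * (\<sigma> ^^ k) (b j))" for y
      using arg_cong[OF coord, of "\<sigma> ^^ k" y] by (simp add: funpow.hom_sum funpow.hom_mult)
    have **: "x * (\<sigma> ^^ k) y = (\<Sum>j<n. x * \<iota> (coord y j) * (\<sigma> ^^ k) (b j))" for x y
      by (subst *[of y]) (simp add: sum_distrib_left mult.assoc)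
    show ?thesis
      unfolding c_def
    proof (induction xs)
      case (Cons p xs)
      then show ?case by (cases p) (simp add: distrib_right sum.distrib flip: **)
    qed simp
  qed
  have cb: "(\<Sum>j<n. c j * (\<sigma> ^^ k) (b j)) = (if k = 0 then 1 else 0)" if "k < m" for k
    using xs that by (auto simp: sum_cb case_prod_beta)
  have bc: "(\<Sum>j<n. b j * (\<sigma> ^^ k) (c j)) = (if k = 0 then 1 else 0)" if "k < m" for k
  proof (cases "k = 0")
    case True
    then show ?thesis using cb[of 0] m by (simp add: mult.commute)
  next
    case False
    \<comment> \<open>Applying \<sigma>^k to the relation \<open>cb\<close> for the exponent m - k
      exchanges the roles of \<open>b\<close> and \<open>c\<close>.\<close>
    have "(\<Sum>j<n. b j * (\<sigma> ^^ k) (c j)) = (\<sigma> ^^ k) (\<Sum>j<n. c j * (\<sigma> ^^ (m - k)) (b j))"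
      using that by (simp add: hom_simps pow_m mult.commute)
    also have "\<dots> = 0" using cb[of "m - k"] False that by simp
    finally show ?thesis using False by simp
  qed
  have expand: "a = (\<Sum>j<n. Tr (c j * a) * b j)" for a
  proof -
    have "(\<Sum>j<n. Tr (c j * a) * b j) = (\<Sum>k<m. (\<sigma> ^^ k) a * (\<Sum>j<n. b j * (\<sigma> ^^ k) (c j)))"
      unfolding Tr_def by (subst sum_distrib_left, subst sum.swap)
        (simp add: sum_distrib_left sum_distrib_right hom_simps mult_ac sum.swap[of _ "{..<m}"])
    also have "\<dots> = (\<Sum>k<m. if k = 0 then a else 0)"
      by (intro sum.cong) (auto simp: bc)
    also have "\<dots> = a" using m by simp
    finally show ?thesis by simp
  qed
  have Tr_cb: "Tr (c i * b j) = (if i = j then 1 else 0)" if ij: "i < n" "j < n" for i j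
  proof -
    have "\<forall>a. \<exists>r. Tr a = \<iota> r" using Tr_range by blast
    then obtain t where t: "\<forall>a. Tr a = \<iota> (t a)" by (rule choice[THEN exE])
    \<comment> \<open>These are the differences of two coordinate vectors of \<open>b j\<close>: the
      one from \<open>expand\<close> and the unit vector.\<close>
    let ?r = "\<lambda>i. t (c i * b j) - (if i = j then 1 else 0)"
    have "(\<Sum>i<n. \<iota> (?r i) * b i) =
        (\<Sum>i<n. Tr (c i * b j) * b i) - (\<Sum>i<n. (if i = j then b i else 0))"
      unfolding sum_subtractf[symmetric] by (intro sum.cong) (simp_all add: hom_simps t left_diff_distrib)
    also have "\<dots> = 0" using ij by (simp flip: expand)
    finally have "?r i = 0" using spec[OF b_indep, of ?r] ij by blast
    then show ?thesis by (auto simp: t)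
  qed
  have cb_shift: "(\<Sum>j<n. (\<sigma> ^^ i) (c j) * (\<sigma> ^^ k) (b j)) = (if i = k then 1 else 0)"
    if "i < m" "k < m" for i k
  proof -
    \<comment> \<open>The residue of k - i modulo m, computed in the natural numbers.\<close>
    define r where "r = (if i \<le> k then k - i else m + k - i)"
    have r: "r < m" "r = 0 \<longleftrightarrow> i = k" using \<open>i < m\<close> \<open>k < m\<close> by (auto simp: r_def)
    have "\<sigma> ^^ k = \<sigma> ^^ (i + r)"
    proof -
      have "i + r = k \<or> i + r = m + k" using \<open>i < m\<close> by (auto simp: r_def)
      then show ?thesis using m(2) funpow_add[of m k \<sigma>] by auto
    qed
    then have "(\<Sum>j<n. (\<sigma> ^^ i) (c j) * (\<sigma> ^^ k) (b j)) = (\<sigma> ^^ i) (\<Sum>j<n. c j * (\<sigma> ^^ r) (b j))"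
      by (simp add: hom_simps funpow_add)
    then show ?thesis
      using cb[OF r(1)] r(2) by auto
  qed
  \<comment> \<open>\<open>Tr_cb\<close> is the identity of size n as a product through m,
    \<open>cb_shift\<close> the identity of size m as a product through n.\<close>
  have "n \<le> m"
    by (rule one_sided_inverse_dim_le[where a = "\<lambda>i k. (\<sigma> ^^ k) (c i)" and b = "\<lambda>k j. (\<sigma> ^^ k) (b j)"])
       (use Tr_cb in \<open>simp add: Tr_def hom_simps\<close>)
  moreover have "m \<le> n"
    by (rule one_sided_inverse_dim_le[where a = "\<lambda>k j. (\<sigma> ^^ k) (c j)" and b = "\<lambda>j k. (\<sigma> ^^ k) (b j)"])
       (rule cb_shift)
  ultimately have mn: "m = n" by simp
  show "\<sigma> ^^ n = id" using m mn by simp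
  show "\<exists>b c. (\<forall>i<n. \<forall>k<n. (\<Sum>j<n. (\<sigma> ^^ i) (c j) * (\<sigma> ^^ k) (b j)) = (if i = k then 1 else 0)) \<and>
     (\<forall>i<n. \<forall>j<n. (\<Sum>k<n. (\<sigma> ^^ k) (c i) * (\<sigma> ^^ k) (b j)) = (if i = j then 1 else 0))"
    using cb_shift Tr_cb mn by (intro exI[of _ b] exI[of _ c]) (simp add: Tr_def hom_simps)
qed

end

text \<open>Fixes one choice of dual families. The two assumptions say that the matrices of
  conjugates of \<open>c\<close> and \<open>b\<close> are inverse to each other, in either
  order.\<close>

locale cyclic_ext_dual = cyclic_ext \<iota> n \<sigma>
  for \<iota> :: "'f::field \<Rightarrow> 'k::field" and n :: nat and \<sigma> :: "'k \<Rightarrow> 'k" +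
  fixes b c :: "nat \<Rightarrow> 'k"
  assumes sum_conj: "i < n \<Longrightarrow> k < n \<Longrightarrow>
      (\<Sum>j<n. (\<sigma> ^^ i) (c j) * (\<sigma> ^^ k) (b j)) = (if i = k then 1 else 0)"
    and trace_dual: "i < n \<Longrightarrow> j < n \<Longrightarrow>
      (\<Sum>k<n. (\<sigma> ^^ k) (c i) * (\<sigma> ^^ k) (b j)) = (if i = j then 1 else 0)"

section \<open>Coefficients and degrees of skew products\<close>

context cyclic_ext
begin

lemmas pow_n = dual_bases(1)

lemma \<sigma>_pow_mod: "\<sigma> ^^ (k mod n) = \<sigma> ^^ k"
  by (rule funpow_mod_eq_of_id) (rule pow_n)

lemma coeff_skew_mult:
  "coeff (skew_mult \<sigma> f g) k = (\<Sum>r\<le>k. coeff f r * (\<sigma> ^^ r) (coeff g (k - r)))"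
proof -
  have inner: "(\<Sum>j\<le>degree g. coeff (monom (coeff f i * (\<sigma> ^^ i) (coeff g j)) (i + j)) k)
      = (if i \<le> k then coeff f i * (\<sigma> ^^ i) (coeff g (k - i)) else 0)" for i
  proof -
    have "(\<Sum>j\<le>degree g. coeff (monom (coeff f i * (\<sigma> ^^ i) (coeff g j)) (i + j)) k)
      = (\<Sum>j\<le>degree g. if j = k - i then (if i \<le> k then coeff f i * (\<sigma> ^^ i) (coeff g j) else 0) else 0)"
      by (intro sum.cong) auto
    also have "\<dots> = (if i \<le> k then coeff f i * (\<sigma> ^^ i) (coeff g (k - i)) else 0)"
      by (auto simp: coeff_eq_0)
    finally show ?thesis .
  qed
  have "coeff (skew_mult \<sigma> f g) k
      = (\<Sum>i\<le>degree f. if i \<le> k then coeff f i * (\<sigma> ^^ i) (coeff g (k - i)) else 0)"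
    unfolding skew_mult_def coeff_sum inner ..
  also have "\<dots> = (\<Sum>i\<in>{..degree f} \<inter> {..k}. coeff f i * (\<sigma> ^^ i) (coeff g (k - i)))"
    by (subst sum.inter_restrict) auto
  also have "\<dots> = (\<Sum>r\<le>k. coeff f r * (\<sigma> ^^ r) (coeff g (k - r)))"
    by (intro sum.mono_neutral_left) (auto simp: coeff_eq_0)
  finally show ?thesis .
qed

text \<open>The top coefficient is \<open>lead_coeff f\<close> times the image of
  \<open>lead_coeff g\<close> under a power of \<sigma>; it is nonzero because \<sigma> is injective
  and K has no zero divisors.\<close>

lemma degree_skew_mult:
  assumes "f \<noteq> 0" "g \<noteq> 0"
  shows "degree (skew_mult \<sigma> f g) = degree f + degree g"
proof (rule antisym)
  show "degree (skew_mult \<sigma> f g) \<le> degree f + degree g"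
  proof (rule degree_le, intro allI impI)
    fix k assume "degree f + degree g < k"
    then have "coeff f r = 0 \<or> coeff g (k - r) = 0" for r
      by (metis coeff_eq_0 less_diff_conv nat_le_linear not_le add.commute add_le_cancel_left le_less_trans)
    then show "coeff (skew_mult \<sigma> f g) k = 0"
      unfolding coeff_skew_mult by (intro sum.neutral) auto
  qed
  have "coeff (skew_mult \<sigma> f g) (degree f + degree g)
      = (\<Sum>r\<le>degree f + degree g. if r = degree f then lead_coeff f * (\<sigma> ^^ degree f) (lead_coeff g) else 0)"
    unfolding coeff_skew_mult
  proof (intro sum.cong refl)
    fix r assume "r \<in> {..degree f + degree g}"
    then have "r \<noteq> degree f \<Longrightarrow> coeff f r = 0 \<or> coeff g (degree f + degree g - r) = 0"
      by (cases "degree f < r") (auto simp: coeff_eq_0)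
    then show "coeff f r * (\<sigma> ^^ r) (coeff g (degree f + degree g - r))
        = (if r = degree f then lead_coeff f * (\<sigma> ^^ degree f) (lead_coeff g) else 0)"
      by auto
  qed
  also have "\<dots> \<noteq> 0" using assms by simp
  finally show "degree f + degree g \<le> degree (skew_mult \<sigma> f g)" by (rule le_degree)
qed

section \<open>The skew polynomial ring as a ring of matrices\<close>

text \<open>Row \<open>i\<close> lists the coordinates of \<open>t\<^sup>i f\<close> in the basis \<open>1, t, \<dots>, t\<^sup>n\<^sup>-\<^sup>1\<close> of the skew polynomial
  ring as a left module over \<open>K[x]\<close>.\<close>

definition rep :: "'k poly \<Rightarrow> 'k poly mat" where
  "rep f = mat n n (\<lambda>(i, j). \<Sum>k\<le>degree f.
     if (k + i) mod n = j then monom ((\<sigma> ^^ i) (coeff f k)) ((k + i) div n) else 0)"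

lemma rep_carrier [simp]: "rep f \<in> carrier_mat n n" "dim_row (rep f) = n" "dim_col (rep f) = n"
  by (simp_all add: rep_def)

text \<open>From t^i a t^k = \<sigma>^i(a) t^(i+k) and t^(j + n q) = x^q t^j, the exponent k must be
  j + n q - i. The guard excludes truncated subtraction.\<close>

lemma coeff_rep:
  assumes "i < n" "j < n"
  shows "coeff (rep f $$ (i, j)) q = (if i \<le> j + n * q then (\<sigma> ^^ i) (coeff f (j + n * q - i)) else 0)"
proof -
  have eq: "(k + i) mod n = j \<and> (k + i) div n = q \<longleftrightarrow> i \<le> j + n * q \<and> k = j + n * q - i" for k
  proof -
    have "(k + i) mod n = j \<and> (k + i) div n = q \<longleftrightarrow> k + i = j + n * q"
      using assms by (metis add.commute add_diff_cancel_left' div_mult_self2 div_less mod_less mod_mult_self2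
          mult_div_mod_eq not_less_zero add_0)
    then show ?thesis by auto
  qed
  have "coeff (rep f $$ (i, j)) q
      = (\<Sum>k\<le>degree f. if (k + i) mod n = j \<and> (k + i) div n = q then (\<sigma> ^^ i) (coeff f k) else 0)"
    using assms by (auto simp: rep_def coeff_sum intro!: sum.cong)
  also have "\<dots> = (\<Sum>k\<le>degree f. if k = j + n * q - i
      then (if i \<le> j + n * q then (\<sigma> ^^ i) (coeff f k) else 0) else 0)"
    unfolding eq by (intro sum.cong) auto
  also have "\<dots> = (if i \<le> j + n * q then (\<sigma> ^^ i) (coeff f (j + n * q - i)) else 0)"
    by (auto simp: coeff_eq_0)
  finally show ?thesis .
qed

lemma rep_eqI:
  assumes "A \<in> carrier_mat n n"
    and "\<And>i j q. i < n \<Longrightarrow> j < n \<Longrightarrow>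
      coeff (A $$ (i, j)) q = (if i \<le> j + n * q then (\<sigma> ^^ i) (coeff f (j + n * q - i)) else 0)"
  shows "A = rep f"
  using assms by (intro eq_matI) (auto simp: poly_eq_iff coeff_rep)

lemma coeff_via_rep: "coeff f k = coeff (rep f $$ (0, k mod n)) (k div n)"
  using n_pos by (simp add: coeff_rep)

lemma rep_inj: "rep f = rep g \<longleftrightarrow> f = g"
  by (metis coeff_via_rep poly_eqI)

lemma rep_first_row_inj:
  assumes "\<And>j. j < n \<Longrightarrow> rep f $$ (0, j) = rep g $$ (0, j)"
  shows "f = g"
proof (rule poly_eqI)
  fix k
  show "coeff f k = coeff g k"
    using assms[of "k mod n"] n_pos by (simp add: coeff_via_rep[of f k] coeff_via_rep[of g k])
qed

lemma rep_add: "rep (f + g) = rep f + rep g"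
  by (intro rep_eqI[symmetric]) (auto simp: coeff_rep hom_simps)

lemma rep_minus: "rep (- f) = - rep f"
  by (intro rep_eqI[symmetric]) (auto simp: coeff_rep funpow.hom_uminus)

lemma rep_0: "rep 0 = 0\<^sub>m n n"
  by (intro rep_eqI[symmetric]) auto

text \<open>Both sides are convolutions over an intermediate exponent s. In the matrix product, s =
  l + n r is split into the inner index l and the power x^r.\<close>

lemma rep_mult: "rep (skew_mult \<sigma> f g) = rep f * rep g"
proof (rule rep_eqI[symmetric])
  fix i j q assume ij: "i < n" "j < n"
  let ?N = "j + n * q"
  let ?h = "\<lambda>s. if i \<le> s \<and> s \<le> ?N then (\<sigma> ^^ i) (coeff f (s - i)) * (\<sigma> ^^ s) (coeff g (?N - s)) else 0"
  have summand: "coeff (rep f $$ (i, l)) r * coeff (rep g $$ (l, j)) (q - r) = ?h (l + n * r)"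
    if l: "l < n" and r: "r \<le> q" for l r
  proof -
    have "j + n * (q - r) + n * r = ?N" using r by (simp flip: distrib_left)
    then have eq: "l \<le> j + n * (q - r) \<longleftrightarrow> l + n * r \<le> ?N" "j + n * (q - r) - l = ?N - (l + n * r)"
      by linarith+
    \<comment> \<open>Here \<sigma>^n = id enters: the twist depends only on the remainder l of s,
      so x is central.\<close>
    have "\<sigma> ^^ (l + n * r) = \<sigma> ^^ l"
      using \<sigma>_pow_mod[of "l + n * r"] l by simp
    then show ?thesis using ij l unfolding coeff_rep[OF ij(1) l] coeff_rep[OF l ij(2)] eq by auto
  qed
  have "coeff ((rep f * rep g) $$ (i, j)) q
      = (\<Sum>l<n. \<Sum>r\<le>q. coeff (rep f $$ (i, l)) r * coeff (rep g $$ (l, j)) (q - r))"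
    using ij by (simp add: scalar_prod_def coeff_sum coeff_mult atLeast0LessThan)
  also have "\<dots> = (\<Sum>l<n. \<Sum>r<Suc q. ?h (l + n * r))"
    unfolding lessThan_Suc_atMost by (intro sum.cong refl summand) auto
  also have "\<dots> = sum ?h {..<n * Suc q}"
    by (subst sum.swap) (rule sum_nat_blocks)
  also have "\<dots> = (if i \<le> ?N then (\<Sum>s=i..?N. (\<sigma> ^^ i) (coeff f (s - i)) * (\<sigma> ^^ s) (coeff g (?N - s))) else 0)"
  proof -
    \<comment> \<open>Full blocks of length n run up to n q + n - 1, possibly beyond
      \<open>?N\<close>; \<open>?h\<close> vanishes there and below i.\<close>
    have "{s. s < n * Suc q \<and> i \<le> s \<and> s \<le> ?N} = {i..?N}" using ij by auto
    then show ?thesis by (auto simp: sum.If_cases Int_def)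
  qed
  also have "\<dots> = (if i \<le> ?N then (\<sigma> ^^ i) (coeff (skew_mult \<sigma> f g) (?N - i)) else 0)"
  proof (cases "i \<le> ?N")
    case True
    have "(\<Sum>s=i..?N. (\<sigma> ^^ i) (coeff f (s - i)) * (\<sigma> ^^ s) (coeff g (?N - s)))
        = (\<Sum>r\<le>?N - i. (\<sigma> ^^ i) (coeff f r) * (\<sigma> ^^ (i + r)) (coeff g (?N - i - r)))"
      using True by (intro sum.reindex_bij_witness[of _ "\<lambda>r. r + i" "\<lambda>s. s - i"]) auto
    also have "\<dots> = (\<sigma> ^^ i) (coeff (skew_mult \<sigma> f g) (?N - i))"
      by (simp add: coeff_skew_mult hom_simps funpow_add)
    finally show ?thesis using True by simp
  qed simp
  finally show "coeff ((rep f * rep g) $$ (i, j)) q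
      = (if i \<le> ?N then (\<sigma> ^^ i) (coeff (skew_mult \<sigma> f g) (?N - i)) else 0)" .
qed (rule mult_carrier_mat[of _ n n], simp_all)

section \<open>Central polynomials as scalar matrices\<close>

lemma coeff_center_poly:
  "coeff (center_poly \<iota> n p) k = (if n dvd k then \<iota> (coeff p (k div n)) else 0)"
proof -
  have "coeff (pcompose q (monom 1 n)) k = (if n dvd k then coeff q (k div n) else 0)"
    for q :: "'k poly" and k
  proof (induction q arbitrary: k)
    case (pCons a q)
    show ?case
    proof (cases "k < n")
      case True
      then show ?thesis
        by (auto simp: pcompose_pCons coeff_monom_mult coeff_pCons dvd_imp_le dest: dvd_imp_le split: nat.splits)
    next
      case False
      then have "k div n = Suc ((k - n) div n)" "k \<noteq> 0" "n dvd k \<longleftrightarrow> n dvd (k - n)"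
        using n_pos by (auto simp: le_div_geq dvd_minus_self)
      then show ?thesis using False
        by (auto simp: pcompose_pCons coeff_monom_mult coeff_pCons pCons.IH split: nat.splits)
    qed
  qed simp
  then show ?thesis by (simp add: center_poly_def coeff_map_poly)
qed

text \<open>A polynomial in t^n with coefficients in F commutes with every t^i, so each row carries
  the same entry, on the diagonal.\<close>

lemma rep_center: "rep (center_poly \<iota> n p) = map_poly \<iota> p \<cdot>\<^sub>m 1\<^sub>m n"
proof (rule rep_eqI[symmetric])
  fix i j q assume ij: "i < n" "j < n"
  have "i \<le> j + n * q \<Longrightarrow> n dvd (j + n * q - i) \<longleftrightarrow> i = j"
  proof -
    assume "i \<le> j + n * q"
    then have "n dvd (j + n * q - i) \<longleftrightarrow> int n dvd (int j - int i + int n * int q)"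
      by (simp add: of_nat_diff flip: int_dvd_int_iff) (simp add: algebra_simps)
    also have "\<dots> \<longleftrightarrow> int n dvd (int j - int i)" by (simp add: dvd_add_left_iff)
    also have "\<dots> \<longleftrightarrow> i = j" using ij zdvd_not_zless[of "int j - int i" "int n"] zdvd_not_zless[of "int i - int j" "int n"]
      by (cases i j rule: linorder_cases) (auto simp: dvd_diff_commute)
    finally show ?thesis .
  qed
  then show "coeff ((map_poly \<iota> p \<cdot>\<^sub>m 1\<^sub>m n) $$ (i, j)) q =
      (if i \<le> j + n * q then (\<sigma> ^^ i) (coeff (center_poly \<iota> n p) (j + n * q - i)) else 0)"
    using ij by (auto simp: coeff_center_poly coeff_map_poly)
qed simp

lemma rep_1: "rep 1 = 1\<^sub>m n"
proof -
  have "rep 1 = 1 \<cdot>\<^sub>m 1\<^sub>m n"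
    using rep_center[of 1] by (simp add: center_poly_def pcompose_1 map_poly_1 pCons_one)
  also have "\<dots> = 1\<^sub>m n" by (intro eq_matI) auto
  finally show ?thesis .
qed

lemma rep_monom:
  assumes "i < n" "j < n"
  shows "rep (monom a k) $$ (i, j) = (if (k + i) mod n = j then monom ((\<sigma> ^^ i) a) ((k + i) div n) else 0)"
proof -
  have *: "i \<le> j + n * q \<and> k = j + n * q - i \<longleftrightarrow> (k + i) mod n = j \<and> (k + i) div n = q" for q
  proof -
    have "(k + i) mod n = j \<and> (k + i) div n = q \<longleftrightarrow> k + i = j + n * q"
      using assms by (metis add.commute add_diff_cancel_left' div_mult_self2 div_less mod_less mod_mult_self2
          mult_div_mod_eq not_less_zero add_0)
    then show ?thesis by auto
  qed
  have "coeff (rep (monom a k) $$ (i, j)) q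
      = (if i \<le> j + n * q \<and> k = j + n * q - i then (\<sigma> ^^ i) a else 0)" for q
    by (simp add: coeff_rep assms)
  then show ?thesis unfolding * by (intro poly_eqI) auto
qed

sublocale map_\<sigma>: map_poly_inj_idom_hom \<sigma> ..
sublocale map_\<iota>: map_poly_inj_idom_hom \<iota> ..

section \<open>The determinant of the matrix representation\<close>

lemma skew_mult_monom: "skew_mult \<sigma> (monom a i) (monom d j) = monom (a * (\<sigma> ^^ i) d) (i + j)"
proof (rule poly_eqI)
  fix k
  have "coeff (skew_mult \<sigma> (monom a i) (monom d j)) k
      = (\<Sum>r\<le>k. if r = i then a * (\<sigma> ^^ i) (coeff (monom d j) (k - i)) else 0)"
    unfolding coeff_skew_mult by (intro sum.cong) auto
  then show "coeff (skew_mult \<sigma> (monom a i) (monom d j)) k = coeff (monom (a * (\<sigma> ^^ i) d) (i + j)) k"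
    by auto
qed

lemma skew_mult_t: "skew_mult \<sigma> (monom 1 1) f = skew_mult \<sigma> (map_poly \<sigma> f) (monom 1 1)"
proof (rule poly_eqI)
  fix k
  have "coeff (skew_mult \<sigma> (monom 1 1) f) k = (\<Sum>r\<le>k. if r = 1 then \<sigma> (coeff f (k - 1)) else 0)"
    unfolding coeff_skew_mult by (intro sum.cong) auto
  also have "\<dots> = (if 1 \<le> k then \<sigma> (coeff f (k - 1)) else 0)" by simp
  also have "\<dots> = (\<Sum>r\<le>k. if r = k - 1 then (if 1 \<le> k then \<sigma> (coeff f r) else 0) else 0)" by simp
  also have "\<dots> = coeff (skew_mult \<sigma> (map_poly \<sigma> f) (monom 1 1)) k"
    unfolding coeff_skew_mult
  proof (intro sum.cong refl)
    fix r assume "r \<in> {..k}"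
    then have "k - r = 1 \<longleftrightarrow> r = k - 1 \<and> 1 \<le> k" by auto
    then show "(if r = k - 1 then (if 1 \<le> k then \<sigma> (coeff f r) else 0) else 0)
        = coeff (map_poly \<sigma> f) r * (\<sigma> ^^ r) (coeff (monom 1 1) (k - r))"
      by (auto simp: coeff_map_poly)
  qed
  finally show "coeff (skew_mult \<sigma> (monom 1 1) f) k = coeff (skew_mult \<sigma> (map_poly \<sigma> f) (monom 1 1)) k" .
qed

lemma center_poly_x: "center_poly \<iota> n [:0, 1:] = monom 1 n"
  by (simp add: center_poly_def pcompose_pCons map_poly_pCons)

text \<open>Since t t^(n-1) = x is scalar, det M(t) divides x^n; this avoids computing the
  determinant of a twisted cyclic permutation.\<close>

lemma det_rep_t: "det (rep (monom 1 1)) \<noteq> 0"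
proof -
  have "rep (monom 1 1) * rep (monom 1 (n - 1)) = rep (monom 1 n)"
    using n_pos by (simp add: skew_mult_monom flip: rep_mult)
  also have "\<dots> = [:0, 1:] \<cdot>\<^sub>m 1\<^sub>m n"
    unfolding center_poly_x[symmetric] rep_center by (simp add: map_poly_pCons)
  finally have "det (rep (monom 1 1)) * det (rep (monom 1 (n - 1))) = [:0, 1:] ^ n"
    using det_mult[of "rep (monom 1 1)" n "rep (monom 1 (n - 1))"] by simp
  then show ?thesis by auto
qed

text \<open>Applying \<sigma> to the coefficients of f applies it to all entries of M(f). The
  relation t f = \<sigma>(f) t then compares the two determinants after cancelling det M(t).\<close>

lemma map_\<sigma>_det_rep: "map_poly \<sigma> (det (rep f)) = det (rep f)"
proof -
  have rep_map: "rep (map_poly \<sigma> f) = map_mat (map_poly \<sigma>) (rep f)"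
    by (intro rep_eqI[symmetric]) (auto simp: coeff_rep coeff_map_poly funpow_swap1)
  have "det (rep (monom 1 1)) * det (rep f) = det (rep (map_poly \<sigma> f)) * det (rep (monom 1 1))"
    by (simp only: skew_mult_t rep_carrier flip: det_mult[of _ n] rep_mult)
  then show ?thesis
    using det_rep_t unfolding rep_map map_\<sigma>.hom_det by simp
qed

lemma poly_in_range:
  assumes "\<And>k. coeff p k \<in> range \<iota>"
  shows "\<exists>q. p = map_poly \<iota> q"
proof
  have "\<iota> (inv_into UNIV \<iota> (coeff p k)) = coeff p k" for k
    using assms by (rule f_inv_into_f)
  \<comment> \<open>\<open>map_poly\<close> acts coefficientwise only for functions that send 0 to
    0.\<close>
  moreover have "inv_into UNIV \<iota> 0 = 0"
    using inv_into_f_f[of \<iota> UNIV 0] \<iota>.inj_f by simp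
  ultimately show "p = map_poly \<iota> (map_poly (inv_into UNIV \<iota>) p)"
    by (intro poly_eqI) (simp add: coeff_map_poly)
qed

lemma det_rep_in_center: "\<exists>q. det (rep f) = map_poly \<iota> q"
proof (rule poly_in_range, rule fixed_imp_range)
  fix k
  show "\<sigma> (coeff (det (rep f)) k) = coeff (det (rep f)) k"
    using arg_cong[OF map_\<sigma>_det_rep[of f], of "\<lambda>p. coeff p k"] by (simp add: coeff_map_poly)
qed

text \<open>The polynomial is the sum of the r_j(x) t^j, written out by exponents k = j + n q. The
  bound \<open>B\<close> exceeds all degrees, so no coefficient is lost.\<close>

lemma rep_first_row_surj:
  fixes r :: "nat \<Rightarrow> 'k poly"
  obtains h where "\<And>j. j < n \<Longrightarrow> rep h $$ (0, j) = r j"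
proof
  define B where "B = Suc (\<Sum>j<n. degree (r j))"
  define h where "h = (\<Sum>k<n * B. monom (coeff (r (k mod n)) (k div n)) k)"
  fix j assume j: "j < n"
  show "rep h $$ (0, j) = r j"
  proof (rule poly_eqI)
    fix q
    have "coeff (r j) q = 0" if "B \<le> q"
    proof (rule coeff_eq_0)
      have "degree (r j) \<le> (\<Sum>j<n. degree (r j))" using j by (intro member_le_sum) auto
      with that show "degree (r j) < q" by (simp add: B_def)
    qed
    moreover have "j + n * q < n * B" if "q < B"
    proof -
      have "j + n * q < n * Suc q" using j by simp
      also have "\<dots> \<le> n * B" using that by (intro mult_le_mono) auto
      finally show ?thesis .
    qed
    ultimately have "coeff h (j + n * q) = coeff (r j) q"
      using j by (cases "q < B") (auto simp: h_def coeff_sum)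
    then show "coeff (rep h $$ (0, j)) q = coeff (r j) q"
      using j n_pos by (simp add: coeff_rep)
  qed
qed

text \<open>The inverse matrix \<open>C\<close> is not known to be of the form M(h). Its first row
  alone determines a candidate h, and the first row of M(h) M(g) = M(h g) being that of the identity
  already forces h g = 1. Degrees add, so both are 0.\<close>

lemma degree_0_if_det_rep_unit:
  assumes "det (rep g) dvd 1"
  shows "degree g = 0"
proof -
  from assms obtain d where d: "det (rep g) * d = 1" by (metis dvdE)
  define C where "C = d \<cdot>\<^sub>m adj_mat (rep g)"
  have C: "C \<in> carrier_mat n n" by (simp add: C_def adj_mat(1)[of _ n])
  have "C * rep g = d \<cdot>\<^sub>m (det (rep g) \<cdot>\<^sub>m 1\<^sub>m n)"
    using adj_mat[OF rep_carrier(1)[of g]] by (simp add: C_def mult_smult_assoc_mat[of _ n n _ n])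
  also have "\<dots> = 1\<^sub>m n" using d by (intro eq_matI) (auto simp: mult.commute)
  finally have C_rep: "C * rep g = 1\<^sub>m n" .
  obtain h where h: "\<And>j. j < n \<Longrightarrow> rep h $$ (0, j) = C $$ (0, j)"
    using rep_first_row_surj[of "\<lambda>j. C $$ (0, j)"] by blast
  have "skew_mult \<sigma> h g = 1"
  proof (rule rep_first_row_inj)
    fix j assume j: "j < n"
    have "(rep h * rep g) $$ (0, j) = (C * rep g) $$ (0, j)"
      using j n_pos C h by (auto simp: scalar_prod_def intro!: sum.cong)
    then show "rep (skew_mult \<sigma> h g) $$ (0, j) = rep 1 $$ (0, j)"
      by (simp add: rep_mult rep_1 C_rep)
  qed
  moreover from this have "h \<noteq> 0" "g \<noteq> 0" by (auto simp: skew_mult_def)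
  ultimately have "degree h + degree g = 0" using degree_skew_mult[of h g] by simp
  then show ?thesis by simp
qed

end

section \<open>The embedding of the algebra of central quotients into matrices over \<open>K(x)\<close>\<close>

lemma fract_lift_Fract:
  assumes "b \<noteq> 0"
    and "\<And>a b a' b'. b \<noteq> 0 \<Longrightarrow> b' \<noteq> 0 \<Longrightarrow> a * b' = a' * b \<Longrightarrow> h a b = h a' b'"
  shows "fract_lift h (Fract a b) = h a b"
  unfolding fract_lift_def
proof (rule the_equality)
  show "\<exists>a' b'. b' \<noteq> 0 \<and> Fract a b = Fract a' b' \<and> h a b = h a' b'" using assms(1) by blast
next
  fix r assume "\<exists>a' b'. b' \<noteq> 0 \<and> Fract a b = Fract a' b' \<and> r = h a' b'"
  then obtain a' b' where *: "b' \<noteq> 0" "Fract a b = Fract a' b'" "r = h a' b'" by blast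
  then have "a' * b = a * b'" using assms(1) by (simp add: eq_fract)
  then show "r = h a b" using assms * by blast
qed

context cyclic_ext
begin

lemma map_ratfun_Fract:
  assumes "q \<noteq> 0"
  shows "map_ratfun \<iota> (Fract p q) = to_fract (map_poly \<iota> p) / to_fract (map_poly \<iota> q)"
proof -
  have "map_ratfun \<iota> (Fract p q) = Fract (map_poly \<iota> p) (map_poly \<iota> q)"
    unfolding map_ratfun_def
    by (rule fract_lift_Fract) (use assms in \<open>simp_all add: eq_fract flip: map_\<iota>.hom_mult\<close>)
  then show ?thesis by (simp add: Fract_conv_to_fract)
qed

lemma map_ratfun_to_fract: "map_ratfun \<iota> (to_fract p) = to_fract (map_poly \<iota> p)"
  using map_ratfun_Fract[of 1 p] by (simp add: to_fract_def flip: One_fract_def)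

sublocale ratfun: field_hom "map_ratfun \<iota>"
proof
  show "map_ratfun \<iota> 0 = 0" "map_ratfun \<iota> 1 = 1"
    using map_ratfun_to_fract[of 0] map_ratfun_to_fract[of 1] by simp_all
  fix c d :: "'f poly fract"
  obtain p q where c: "c = Fract p q" "q \<noteq> 0" by (cases c)
  obtain p' q' where d: "d = Fract p' q'" "q' \<noteq> 0" by (cases d)
  show "map_ratfun \<iota> (c + d) = map_ratfun \<iota> c + map_ratfun \<iota> d"
    using c d by (simp add: map_ratfun_Fract map_\<iota>.hom_add map_\<iota>.hom_mult add_frac_eq)
  show "map_ratfun \<iota> (c * d) = map_ratfun \<iota> c * map_ratfun \<iota> d"
    using c d by (simp add: map_ratfun_Fract map_\<iota>.hom_mult)
qed

definition rep_fract :: "'k poly \<Rightarrow> 'k poly fract mat" where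
  "rep_fract f = map_mat to_fract (rep f)"

lemma rep_fract_carrier [simp]: "rep_fract f \<in> carrier_mat n n"
    "dim_row (rep_fract f) = n" "dim_col (rep_fract f) = n"
  by (simp_all add: rep_fract_def)

lemma rep_fract_mult: "rep_fract (skew_mult \<sigma> f g) = rep_fract f * rep_fract g"
  by (simp add: rep_fract_def rep_mult to_fract_hom.mat_hom_mult[of _ n n _ n])

lemma rep_fract_add: "rep_fract (f + g) = rep_fract f + rep_fract g"
  by (intro eq_matI) (simp_all add: rep_fract_def rep_add)

lemma rep_fract_minus: "rep_fract (- f) = - rep_fract f"
  by (intro eq_matI) (simp_all add: rep_fract_def rep_minus)

lemma rep_fract_center: "rep_fract (center_poly \<iota> n p) = to_fract (map_poly \<iota> p) \<cdot>\<^sub>m 1\<^sub>m n"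
  by (intro eq_matI) (simp_all add: rep_fract_def rep_center)

lemma rep_fract_inj: "rep_fract f = rep_fract g \<longleftrightarrow> f = g"
proof
  assume "rep_fract f = rep_fract g"
  then have "rep f = rep g" unfolding rep_fract_def by (rule to_fract_hom.mat_hom_inj)
  then show "f = g" by (simp add: rep_inj)
qed simp

lemma rep_fract_0: "rep_fract 0 = 0\<^sub>m n n"
  by (intro eq_matI) (simp_all add: rep_fract_def rep_0)

lemma rep_fract_1: "rep_fract 1 = 1\<^sub>m n"
  by (intro eq_matI) (simp_all add: rep_fract_def rep_1)

lemma det_rep_fract: "det (rep_fract f) = to_fract (det (rep f))"
  by (simp add: rep_fract_def)

text \<open>For a central denominator \<open>g\<close> the matrix of \<open>g\<close> is scalar, and its first entry is \<open>g\<close> itself.\<close>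

definition quot_rep :: "'k poly \<Rightarrow> 'k poly \<Rightarrow> 'k poly fract mat" where
  "quot_rep f g = inverse (rep_fract g $$ (0, 0)) \<cdot>\<^sub>m rep_fract f"

lemma quot_rep_center:
  "quot_rep f (center_poly \<iota> n q) = inverse (to_fract (map_poly \<iota> q)) \<cdot>\<^sub>m rep_fract f"
  using n_pos by (simp add: quot_rep_def rep_fract_center)

lemma center_poly_1: "center_poly \<iota> n 1 = 1"
  by (simp add: center_poly_def map_poly_1 pcompose_1)

lemma quot_rep_1: "quot_rep f 1 = rep_fract f"
  using quot_rep_center[of f 1] by (simp add: center_poly_1) (intro eq_matI, auto)

lemma center_poly_mult: "skew_mult \<sigma> (center_poly \<iota> n p) (center_poly \<iota> n q) = center_poly \<iota> n (p * q)"
  unfolding rep_inj[symmetric] rep_mult rep_center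
  by (intro eq_matI) (simp_all add: map_\<iota>.hom_mult mult_smult_assoc_mat[of _ n n _ n] left_mult_one_mat[of _ n n])

lemma rep_fract_mult_center:
  "rep_fract (skew_mult \<sigma> f (center_poly \<iota> n q)) = to_fract (map_poly \<iota> q) \<cdot>\<^sub>m rep_fract f"
  by (simp add: rep_fract_mult rep_fract_center mult_smult_distrib[of _ n n _ n] right_mult_one_mat[of _ n n])

text \<open>Sends f/g to M(f) divided by the scalar of M(g). Equality of fractions matches equality
  of matrices because M is injective and turns central denominators into scalars.\<close>

sublocale Q: fraction_embedding "ring_mat TYPE('k poly fract) n ()" "skew_ring \<sigma>"
    "center_denoms \<iota> n" quot_rep
  rewrites "carrier (skew_ring \<sigma>) = UNIV"
    and "mult (skew_ring \<sigma>) = skew_mult \<sigma>"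
    and "add (skew_ring \<sigma>) = (+)"
    and "one (skew_ring \<sigma>) = 1"
    and "zero (skew_ring \<sigma>) = 0"
    and "quot_ring (skew_ring \<sigma>) (center_denoms \<iota> n) = skew_quot_ring \<iota> n \<sigma>"
    and "quot (skew_ring \<sigma>) (center_denoms \<iota> n) = skew_quot \<iota> n \<sigma>"
proof -
  let ?M = "ring_mat TYPE('k poly fract) n ()"
  let ?R = "skew_ring \<sigma>"
  show R: "carrier ?R = UNIV" "mult ?R = skew_mult \<sigma>" "add ?R = (+)" "one ?R = 1" "zero ?R = 0"
    by (simp_all add: skew_ring_def)
  show "quot_ring ?R (center_denoms \<iota> n) = skew_quot_ring \<iota> n \<sigma>"
    "quot ?R (center_denoms \<iota> n) = skew_quot \<iota> n \<sigma>"
    by (simp_all add: skew_quot_ring_def skew_quot_def)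
  interpret M: ring ?M by (rule ring_mat)
  show "fraction_embedding ?M ?R (center_denoms \<iota> n) quot_rep"
  proof (unfold_locales, unfold R ring_mat_simps)
    show "1 \<in> center_denoms \<iota> n"
      using center_poly_1 by (force simp: center_denoms_def)
    show "quot_rep 1 1 = 1\<^sub>m n" "quot_rep 0 1 = 0\<^sub>m n n"
      by (simp_all add: quot_rep_1 rep_fract_1 rep_fract_0)
  next
    fix g g' assume "g \<in> center_denoms \<iota> n" "g' \<in> center_denoms \<iota> n"
    then obtain q q' where q: "g = center_poly \<iota> n q" "q \<noteq> 0" "g' = center_poly \<iota> n q'" "q' \<noteq> 0"
      by (auto simp: center_denoms_def)
    then show "skew_mult \<sigma> g g' \<in> center_denoms \<iota> n"
      by (auto simp: center_poly_mult center_denoms_def)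
    fix f f'
    have eq: "inverse (to_fract (map_poly \<iota> q)) * x = inverse (to_fract (map_poly \<iota> q')) * y \<longleftrightarrow>
      to_fract (map_poly \<iota> q') * x = to_fract (map_poly \<iota> q) * y" for x y
      using q by (simp add: field_simps)
    show "quot_rep f g = quot_rep f' g' \<longleftrightarrow> skew_mult \<sigma> f g' = skew_mult \<sigma> f' g"
      unfolding q quot_rep_center rep_fract_inj[symmetric] rep_fract_mult_center
      by (simp add: mat_eq_iff rep_fract_def eq)
    show "quot_rep (skew_mult \<sigma> f f') (skew_mult \<sigma> g g') = quot_rep f g * quot_rep f' g'"
      unfolding q center_poly_mult quot_rep_center rep_fract_mult
      by (intro eq_matI) (auto simp: map_\<iota>.hom_mult mult_smult_distrib[of _ n n _ n] mult_smult_assoc_mat[of _ n n _ n])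
    show "quot_rep (skew_mult \<sigma> f g' + skew_mult \<sigma> f' g) (skew_mult \<sigma> g g') = quot_rep f g + quot_rep f' g'"
      unfolding q center_poly_mult quot_rep_center rep_fract_add rep_fract_mult_center
      using q by (intro eq_matI) (auto simp: map_\<iota>.hom_mult field_simps)
  next
    fix f g
    have "quot_rep (- f) g \<oplus>\<^bsub>?M\<^esub> quot_rep f g = \<zero>\<^bsub>?M\<^esub>"
      unfolding ring_mat_simps
      by (intro eq_matI) (auto simp: quot_rep_def rep_fract_minus)
    then have "quot_rep (- f) g = \<ominus>\<^bsub>?M\<^esub> quot_rep f g"
      by (intro M.minus_equality[symmetric]) (auto simp: ring_mat_simps quot_rep_def)
    then show "\<exists>f'\<in>UNIV. quot_rep f' g = \<ominus>\<^bsub>?M\<^esub> quot_rep f g" by blast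
  qed (auto simp: quot_rep_def)
qed

lemma center_poly_in_denoms: "q \<noteq> 0 \<Longrightarrow> center_poly \<iota> n q \<in> center_denoms \<iota> n"
  by (auto simp: center_denoms_def)

lemma one_in_denoms: "1 \<in> center_denoms \<iota> n"
  using Q.S_closed(3) .

lemma center_fract_Fract:
  assumes "q \<noteq> 0"
  shows "center_fract \<iota> n \<sigma> (Fract p q) = skew_quot \<iota> n \<sigma> (center_poly \<iota> n p) (center_poly \<iota> n q)"
  unfolding center_fract_def
proof (rule fract_lift_Fract[OF assms])
  fix a b a' b' :: "'f poly"
  assume "b \<noteq> 0" "b' \<noteq> 0" "a * b' = a' * b"
  then show "skew_quot \<iota> n \<sigma> (center_poly \<iota> n a) (center_poly \<iota> n b)
      = skew_quot \<iota> n \<sigma> (center_poly \<iota> n a') (center_poly \<iota> n b')"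
    by (subst Q.quot_eq_iff) (auto simp: center_poly_in_denoms Q.\<psi>_eq center_poly_mult)
qed

lemma center_fract_carrier: "center_fract \<iota> n \<sigma> c \<in> carrier (skew_quot_ring \<iota> n \<sigma>)"
  by (cases c) (simp add: center_fract_Fract center_poly_in_denoms Q.quot_carrier)

lemma Psi_center_fract: "Q.Psi (center_fract \<iota> n \<sigma> c) = map_ratfun \<iota> c \<cdot>\<^sub>m 1\<^sub>m n"
proof (cases c)
  case (Fract p q)
  then show ?thesis
    by (intro eq_matI) (simp_all add: center_fract_Fract center_poly_in_denoms quot_rep_center
        rep_fract_center map_ratfun_Fract divide_inverse mult.commute)
qed

text \<open>By injectivity of \<open>Q.Psi\<close>, identities for the embedded centre are checked
  on scalar matrices.\<close>

lemma center_fract_eqI: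
  assumes "y \<in> carrier (skew_quot_ring \<iota> n \<sigma>)" "Q.Psi y = map_ratfun \<iota> c \<cdot>\<^sub>m 1\<^sub>m n"
  shows "center_fract \<iota> n \<sigma> c = y"
  using assms by (intro inj_onD[OF Q.Psi_inj]) (simp_all add: Psi_center_fract center_fract_carrier)

lemma scalar_mat_mult: "(a \<cdot>\<^sub>m 1\<^sub>m n) * (d \<cdot>\<^sub>m 1\<^sub>m n) = (a * d) \<cdot>\<^sub>m (1\<^sub>m n :: 'k poly fract mat)"
proof -
  have "(a \<cdot>\<^sub>m 1\<^sub>m n) * (d \<cdot>\<^sub>m 1\<^sub>m n) = a \<cdot>\<^sub>m (d \<cdot>\<^sub>m (1\<^sub>m n :: 'k poly fract mat))"
    by (simp add: mult_smult_assoc_mat[of _ n n _ n] left_mult_one_mat[of _ n n])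
  then show ?thesis by (auto intro: eq_matI)
qed

lemma center_fract_hom:
  "center_fract \<iota> n \<sigma> (c + d) = center_fract \<iota> n \<sigma> c \<oplus>\<^bsub>skew_quot_ring \<iota> n \<sigma>\<^esub> center_fract \<iota> n \<sigma> d"
  "center_fract \<iota> n \<sigma> (c * d) = center_fract \<iota> n \<sigma> c \<otimes>\<^bsub>skew_quot_ring \<iota> n \<sigma>\<^esub> center_fract \<iota> n \<sigma> d"
  "center_fract \<iota> n \<sigma> 1 = \<one>\<^bsub>skew_quot_ring \<iota> n \<sigma>\<^esub>"
  "center_fract \<iota> n \<sigma> 0 = \<zero>\<^bsub>skew_quot_ring \<iota> n \<sigma>\<^esub>"
proof -
  interpret A: ring "skew_quot_ring \<iota> n \<sigma>" by (rule Q.ring_Q)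
  show "center_fract \<iota> n \<sigma> (c + d) = center_fract \<iota> n \<sigma> c \<oplus>\<^bsub>skew_quot_ring \<iota> n \<sigma>\<^esub> center_fract \<iota> n \<sigma> d"
    by (intro center_fract_eqI eq_matI)
      (simp_all add: center_fract_carrier Q.Psi_hom_props Psi_center_fract ring_mat_simps ratfun.hom_add)
  show "center_fract \<iota> n \<sigma> (c * d) = center_fract \<iota> n \<sigma> c \<otimes>\<^bsub>skew_quot_ring \<iota> n \<sigma>\<^esub> center_fract \<iota> n \<sigma> d"
    by (intro center_fract_eqI)
      (simp_all add: center_fract_carrier Q.Psi_hom_props Psi_center_fract ring_mat_simps ratfun.hom_mult
        scalar_mat_mult)
  show "center_fract \<iota> n \<sigma> 1 = \<one>\<^bsub>skew_quot_ring \<iota> n \<sigma>\<^esub>"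
    by (intro center_fract_eqI eq_matI) (simp_all add: Q.Psi_hom_props ring_mat_simps)
  show "center_fract \<iota> n \<sigma> 0 = \<zero>\<^bsub>skew_quot_ring \<iota> n \<sigma>\<^esub>"
    by (intro center_fract_eqI eq_matI) (simp_all add: Q.Psi_hom_props ring_mat_simps)
qed

lemma one_mat_neq_0: "1\<^sub>m n \<noteq> (0\<^sub>m n n :: 'k poly fract mat)"
proof
  assume "1\<^sub>m n = (0\<^sub>m n n :: 'k poly fract mat)"
  then have "1\<^sub>m n $$ (0, 0) = (0\<^sub>m n n :: 'k poly fract mat) $$ (0, 0)" by simp
  then show False using n_pos by simp
qed

lemma subfield_center: "subfield (range (center_fract \<iota> n \<sigma>)) (skew_quot_ring \<iota> n \<sigma>)"
proof (rule ring.subfield_range[OF Q.ring_Q])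
  show "\<one>\<^bsub>skew_quot_ring \<iota> n \<sigma>\<^esub> \<noteq> \<zero>\<^bsub>skew_quot_ring \<iota> n \<sigma>\<^esub>"
    using Q.Psi_hom_props(6,7) one_mat_neq_0 by (auto simp: ring_mat_simps)
qed (simp_all add: center_fract_carrier center_fract_hom)

lemma subfield_scalar: "subfield (range (\<lambda>l. l \<cdot>\<^sub>m 1\<^sub>m n)) (ring_mat TYPE('k poly fract) n ())"
  by (rule ring.subfield_range[OF ring_mat])
    (auto simp: ring_mat_simps one_mat_neq_0 scalar_mat_mult add_smult_distrib_right_mat)

definition const_fract :: "'k \<Rightarrow> 'k poly fract" where
  "const_fract a = to_fract [:a:]"

sublocale const_fract: field_hom const_fract
proof
  show "const_fract 0 = 0" "const_fract 1 = 1"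
    by (simp_all add: const_fract_def pCons_one)
  show "const_fract (a + d) = const_fract a + const_fract d" for a d
    by (simp add: const_fract_def flip: to_fract_add)
  show "const_fract (a * d) = const_fract a * const_fract d" for a d
    by (simp add: const_fract_def flip: to_fract_mult)
qed

lemma rep_fract_monom:
  assumes "i < n" "j < n"
  shows "rep_fract (monom a k) $$ (i, j)
    = (if (k + i) mod n = j then const_fract ((\<sigma> ^^ i) a) * to_fract (monom 1 ((k + i) div n)) else 0)"
  using assms by (simp add: rep_fract_def rep_monom const_fract_def smult_monom flip: to_fract_mult)

end

section \<open>A basis of the algebra that becomes a basis of the matrices over K(x)\<close>

context cyclic_ext_dual
begin

text \<open>The element b_j t^i, where r = j + n i enumerates the pairs.\<close>

definition basis_poly :: "nat \<Rightarrow> 'k poly" where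
  "basis_poly r = monom (b (r mod n)) (r div n)"

abbreviation "basis_mats \<equiv> map (\<lambda>r. rep_fract (basis_poly r)) [0..<n * n]"

abbreviation "mat_combine \<equiv> ring.combine (ring_mat TYPE('k poly fract) n ())"

text \<open>The matrix of b_j t^i lives on the i-th cyclic diagonal, the entries (l, (i + l) mod n),
  with a factor x after wrapping around. Hence each diagonal involves only n of the
  coefficients.\<close>

lemma combine_basis:
  assumes "length ls = n * n" "i < n" "l < n"
  shows "mat_combine (map (\<lambda>l. l \<cdot>\<^sub>m 1\<^sub>m n) ls) basis_mats $$ (l, (i + l) mod n)
    = (\<Sum>j<n. ls ! (j + n * i) * const_fract ((\<sigma> ^^ l) (b j))) * to_fract (monom 1 ((i + l) div n))"
proof -
  \<comment> \<open>Adding (n - 1) l undoes the shift by l modulo n.\<close>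
  have unshift: "((k + l) mod n + (n - 1) * l) mod n = k" if "k < n" for k
  proof -
    have "k + l + (n - 1) * l = k + n * l" by (cases n) (use n_pos in auto)
    then show ?thesis using that unfolding mod_add_left_eq by (simp only: mod_mult_self2 mod_less)
  qed
  have eq: "(i' + l) mod n = (i + l) mod n \<longleftrightarrow> i' = i" if "i' < n" for i'
    using unshift[OF that] unshift[OF assms(2)] by metis
  have "mat_combine (map (\<lambda>l. l \<cdot>\<^sub>m 1\<^sub>m n) ls) basis_mats $$ (l, (i + l) mod n)
      = (\<Sum>r<n * n. ls ! r * rep_fract (basis_poly r) $$ (l, (i + l) mod n))"
    using assms by (subst combine_scalar_mat) auto
  also have "\<dots> = (\<Sum>i'<n. \<Sum>j<n. ls ! (j + n * i') * rep_fract (basis_poly (j + n * i')) $$ (l, (i + l) mod n))"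
    by (rule sum_nat_blocks[symmetric])
  also have "\<dots> = (\<Sum>i'<n. if i' = i then
      (\<Sum>j<n. ls ! (j + n * i) * const_fract ((\<sigma> ^^ l) (b j))) * to_fract (monom 1 ((i + l) div n)) else 0)"
    using assms eq
    by (intro sum.cong refl) (auto simp: basis_poly_def rep_fract_monom sum_distrib_right mult.assoc)
  also have "\<dots> = (\<Sum>j<n. ls ! (j + n * i) * const_fract ((\<sigma> ^^ l) (b j))) * to_fract (monom 1 ((i + l) div n))"
    using assms by simp
  finally show ?thesis .
qed

text \<open>The n entries of one diagonal give a linear system with matrix \<sigma>^l(b_k), inverted
  by \<open>trace_dual\<close>. With coefficients in K(x), this serves both for the matrices and,
  through \<open>map_ratfun\<close>, for the algebra over F(x).\<close>

lemma mat_indep: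
  assumes len: "length ls = n * n"
    and zero: "mat_combine (map (\<lambda>l. l \<cdot>\<^sub>m 1\<^sub>m n) ls) basis_mats = 0\<^sub>m n n"
  shows "set ls \<subseteq> {0}"
proof -
  have "ls ! (j + n * i) = 0" if i: "i < n" and j: "j < n" for i j
  proof -
    have conj: "(\<Sum>k<n. ls ! (k + n * i) * const_fract ((\<sigma> ^^ l) (b k))) = 0" if l: "l < n" for l
    proof -
      have "(\<Sum>k<n. ls ! (k + n * i) * const_fract ((\<sigma> ^^ l) (b k))) * to_fract (monom 1 ((i + l) div n)) = 0"
        using combine_basis[OF len i l] l by (simp add: zero)
      then show ?thesis by simp
    qed
    have "ls ! (j + n * i) = (\<Sum>k<n. if j = k then ls ! (k + n * i) else 0)" using j by simp
    also have "\<dots> = (\<Sum>k<n. ls ! (k + n * i) *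
        const_fract (\<Sum>l<n. (\<sigma> ^^ l) (c j) * (\<sigma> ^^ l) (b k)))"
      using j by (intro sum.cong) (auto simp: trace_dual)
    also have "\<dots> = (\<Sum>l<n. const_fract ((\<sigma> ^^ l) (c j)) * (\<Sum>k<n. ls ! (k + n * i) * const_fract ((\<sigma> ^^ l) (b k))))"
      unfolding const_fract.hom_sum const_fract.hom_mult sum_distrib_left
      by (subst sum.swap) (simp add: mult.left_commute)
    also have "\<dots> = 0" by (simp add: conj)
    finally show ?thesis .
  qed
  moreover have "\<exists>i<n. \<exists>j<n. r = j + n * i" if "r < n * n" for r
    using that n_pos by (intro exI[of _ "r div n"] conjI exI[of _ "r mod n"]) (auto simp: less_mult_imp_div_less)
  ultimately show ?thesis
    using len by (force simp: set_conv_nth)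
qed

text \<open>Solves the system of \<open>combine_basis\<close>: strip the powers of x from diagonal i
  and pair it with the conjugates of \<open>c j\<close>.\<close>

definition mat_coord :: "'k poly fract mat \<Rightarrow> nat \<Rightarrow> nat \<Rightarrow> 'k poly fract" where
  "mat_coord X i j = (\<Sum>l<n. const_fract ((\<sigma> ^^ l) (c j)) *
     (X $$ (l, (i + l) mod n) / to_fract (monom 1 ((i + l) div n))))"

lemma mat_span:
  assumes X: "X \<in> carrier_mat n n"
  shows "mat_combine (map (\<lambda>l. l \<cdot>\<^sub>m 1\<^sub>m n) (map (\<lambda>r. mat_coord X (r div n) (r mod n)) [0..<n * n])) basis_mats = X"
    (is "?Y = X")
proof (rule eq_matI)
  let ?ls = "map (\<lambda>r. mat_coord X (r div n) (r mod n)) [0..<n * n]"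
  have "?Y \<in> carrier_mat n n"
    by (rule combine_scalar_mat(1)[of _ _ _ 0 0]) (auto simp: n_pos)
  then show "dim_row ?Y = dim_row X" "dim_col ?Y = dim_col X" using X by auto
  fix l m assume "l < dim_row X" "m < dim_col X"
  then have l: "l < n" and m: "m < n" using X by auto
  \<comment> \<open>The cyclic diagonal through (l, m), that is m - l modulo n.\<close>
  define i where "i = (m + (n - l)) mod n"
  have i: "i < n" "(i + l) mod n = m"
    using l m by (auto simp: i_def mod_add_left_eq)
  let ?x = "to_fract (monom 1 ((i + l) div n)) :: 'k poly fract"
  have ls: "?ls ! (j + n * i) = mat_coord X i j" if "j < n" for j
  proof -
    have "j + n * i < n * Suc i" using that by simp
    also have "\<dots> \<le> n * n" using i by (intro mult_le_mono) auto
    finally show ?thesis using that by simp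
  qed
  have "(\<Sum>j<n. mat_coord X i j * const_fract ((\<sigma> ^^ l) (b j)))
      = (\<Sum>l'<n. X $$ (l', (i + l') mod n) / to_fract (monom 1 ((i + l') div n)) *
          const_fract (\<Sum>j<n. (\<sigma> ^^ l') (c j) * (\<sigma> ^^ l) (b j)))"
    unfolding mat_coord_def const_fract.hom_sum const_fract.hom_mult sum_distrib_left sum_distrib_right
    by (subst sum.swap) (simp add: mult_ac)
  also have "\<dots> = (\<Sum>l'<n. if l' = l then X $$ (l, m) / ?x else 0)"
    using l i by (intro sum.cong) (auto simp: sum_conj)
  also have "\<dots> = X $$ (l, m) / ?x" using l by simp
  finally have "(\<Sum>j<n. mat_coord X i j * const_fract ((\<sigma> ^^ l) (b j))) * ?x = X $$ (l, m)"
    by simp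
  then show "?Y $$ (l, m) = X $$ (l, m)"
    using combine_basis[of ?ls i l] i l ls by simp
qed

section \<open>Coordinates of elements of the algebra lie in F(x)\<close>

definition trace :: "'k \<Rightarrow> 'k" where
  "trace a = (\<Sum>k<n. (\<sigma> ^^ k) a)"

lemma trace_in_range: "trace a \<in> range \<iota>"
proof (rule fixed_imp_range)
  have "\<sigma> (trace a) + a = (\<Sum>k<Suc n. (\<sigma> ^^ k) a)"
    unfolding trace_def by (subst sum.lessThan_Suc_shift) (simp add: \<sigma>.hom_sum)
  also have "\<dots> = trace a + a" by (simp add: pow_n trace_def)
  finally show "\<sigma> (trace a) = trace a" by simp
qed

text \<open>If f is the sum of the f_i(x) t^i, then t^l f is the sum of the \<sigma>^l(f_i)(x)
  t^(i+l), and t^n = x.\<close>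

lemma rep_shifted_entry:
  assumes "i < n" "l < n"
  shows "rep f $$ (l, (i + l) mod n) = map_poly (\<sigma> ^^ l) (rep f $$ (0, i)) * monom 1 ((i + l) div n)"
proof (rule poly_eqI)
  fix q
  have "coeff (rep f $$ (l, (i + l) mod n)) q
      = (if (i + l) div n \<le> q then (\<sigma> ^^ l) (coeff f (i + n * (q - (i + l) div n))) else 0)"
  proof (cases "(i + l) div n \<le> q")
    case True
    then obtain s where s: "q = (i + l) div n + s" using le_Suc_ex by blast
    have "(i + l) mod n + n * q = i + l + n * s"
      unfolding s distrib_left by (simp add: mult_div_mod_eq flip: add.assoc) 
    then show ?thesis using assms by (simp add: coeff_rep s)
  next
    case False
    have "(i + l) div n < 2" using assms by (simp add: div_less_iff_less_mult)
    then have "q = 0" "(i + l) div n = 1" using False by auto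
    then have "(i + l) mod n + n = i + l" using mod_mult_div_eq[of "i + l" n] by simp
    then have "\<not> l \<le> (i + l) mod n + n * q" using assms \<open>q = 0\<close> by simp
    then show ?thesis using assms False by (simp add: coeff_rep)
  qed
  then show "coeff (rep f $$ (l, (i + l) mod n)) q
      = coeff (map_poly (\<sigma> ^^ l) (rep f $$ (0, i)) * monom 1 ((i + l) div n)) q"
    using assms n_pos by (simp add: coeff_monom_mult mult.commute[of _ "monom _ _"] coeff_map_poly coeff_rep)
qed

text \<open>On matrices from the algebra the powers of x cancel, and the coordinate is the
  coefficientwise trace of c_j f_i, divided by q.\<close>

lemma mat_coord_quot_rep:
  assumes "q \<noteq> 0" "i < n"
  shows "mat_coord (quot_rep f (center_poly \<iota> n q)) i j \<in> range (map_ratfun \<iota>)"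
proof -
  let ?g = "rep f $$ (0, i)"
  let ?T = "\<Sum>l<n. [:(\<sigma> ^^ l) (c j):] * map_poly (\<sigma> ^^ l) ?g"
  have "coeff ?T k \<in> range \<iota>" for k
    using trace_in_range[of "c j * coeff ?g k"] by (simp add: trace_def coeff_sum coeff_map_poly funpow.hom_mult)
  then obtain p where p: "?T = map_poly \<iota> p" using poly_in_range by blast
  have "mat_coord (quot_rep f (center_poly \<iota> n q)) i j
      = (\<Sum>l<n. const_fract ((\<sigma> ^^ l) (c j)) * to_fract (map_poly (\<sigma> ^^ l) ?g)) / to_fract (map_poly \<iota> q)"
    using assms(2) n_pos unfolding mat_coord_def sum_divide_distrib
    by (intro sum.cong) (simp_all add: quot_rep_center rep_fract_def rep_shifted_entry divide_inverse)
  also have "\<dots> = to_fract ?T / to_fract (map_poly \<iota> q)"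
    by (simp add: const_fract_def flip: to_fract_mult)
  also have "\<dots> = map_ratfun \<iota> (Fract p q)"
    using assms p by (simp add: map_ratfun_Fract)
  finally show ?thesis by simp
qed

text \<open>The expansion over K(x) from \<open>mat_span\<close> has coordinates in F(x) when the
  matrix comes from the algebra, so it pulls back along the injective map
  \<open>Q.Psi\<close>.\<close>

theorem splitting_Psi:
  "splitting (skew_quot_ring \<iota> n \<sigma>) (center_fract \<iota> n \<sigma>) (map_ratfun \<iota>) n Q.Psi"
proof -
  let ?A = "skew_quot_ring \<iota> n \<sigma>" and ?M = "ring_mat TYPE('k poly fract) n ()"
  let ?e = "center_fract \<iota> n \<sigma>"
  let ?us = "map (\<lambda>r. skew_quot \<iota> n \<sigma> (basis_poly r) 1) [0..<n * n]"
  interpret A: ring ?A by (rule Q.ring_Q)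
  interpret Psi: ring_hom_ring ?A ?M Q.Psi by (rule Q.Psi_hom)
  have us: "set ?us \<subseteq> carrier ?A" by (auto intro!: Q.quot_carrier one_in_denoms)
  have Psi_us: "map Q.Psi ?us = basis_mats"
    by (simp add: one_in_denoms quot_rep_1 comp_def)
  have Psi_combine: "Q.Psi (A.combine (map ?e cs) ?us)
      = mat_combine (map (\<lambda>l. l \<cdot>\<^sub>m 1\<^sub>m n) (map (map_ratfun \<iota>) cs)) basis_mats" for cs
  proof -
    have "set (map ?e cs) \<subseteq> carrier ?A" using center_fract_carrier by auto
    from Psi.combine_hom[OF this us, symmetric] show ?thesis
      unfolding Psi_us by (simp add: comp_def Psi_center_fract)
  qed
  have ex_map: "\<exists>cs. ks = map e cs" if "set ks \<subseteq> range e" for e :: "'x \<Rightarrow> 'y" and ks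
    using that by (metis ex_map_conv rangeE subsetD)
  have "algebra_basis ?A (range ?e) ?us"
  proof (rule A.algebra_basisI[OF subfield_center us])
    fix ks assume ks: "set ks \<subseteq> range ?e" "length ks = length ?us" "A.combine ks ?us = \<zero>\<^bsub>?A\<^esub>"
    then obtain cs where cs: "ks = map ?e cs" using ex_map by metis
    have "set (map (map_ratfun \<iota>) cs) \<subseteq> {0}"
      using ks cs Psi_combine[of cs] by (intro mat_indep) (auto simp: Q.Psi_hom_props ring_mat_simps)
    then show "set ks \<subseteq> {\<zero>\<^bsub>?A\<^esub>}" by (auto simp: cs center_fract_hom)
  next
    fix x assume x: "x \<in> carrier ?A"
    then obtain f q where q: "x = skew_quot \<iota> n \<sigma> f (center_poly \<iota> n q)" "q \<noteq> 0"
      by (elim Q.Q_cases) (auto simp: center_denoms_def)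
    then have Psi_x: "Q.Psi x = quot_rep f (center_poly \<iota> n q)"
      by (simp add: center_poly_in_denoms)
    let ?ls = "map (\<lambda>r. mat_coord (Q.Psi x) (r div n) (r mod n)) [0..<n * n]"
    have "set ?ls \<subseteq> range (map_ratfun \<iota>)"
      using mat_coord_quot_rep[OF q(2)] by (auto simp: Psi_x less_mult_imp_div_less)
    then obtain cs where cs: "?ls = map (map_ratfun \<iota>) cs" using ex_map by metis
    have comb: "A.combine (map ?e cs) ?us \<in> carrier ?A"
      using us center_fract_carrier by (intro A.combine_in_carrier) auto
    have "Q.Psi (A.combine (map ?e cs) ?us) = Q.Psi x"
      unfolding Psi_combine cs[symmetric]
      using Q.Psi_hom_props(1)[OF x] by (intro mat_span) (simp add: ring_mat_simps)
    then have "A.combine (map ?e cs) ?us = x"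
      using comb x by (rule inj_onD[OF Q.Psi_inj])
    then show "\<exists>ks. set ks \<subseteq> range ?e \<and> A.combine ks ?us = x"
      by (intro exI[of _ "map ?e cs"]) auto
  qed
  moreover have "algebra_basis ?M (range (\<lambda>l. l \<cdot>\<^sub>m 1\<^sub>m n)) (map Q.Psi ?us)"
    unfolding Psi_us
  proof (rule ring.algebra_basisI[OF ring_mat subfield_scalar])
    show "set basis_mats \<subseteq> carrier ?M" by (auto simp: ring_mat_simps)
  next
    fix ks assume ks: "set ks \<subseteq> range (\<lambda>l :: 'k poly fract. l \<cdot>\<^sub>m 1\<^sub>m n)" "length ks = length basis_mats"
      "mat_combine ks basis_mats = \<zero>\<^bsub>?M\<^esub>"
    then obtain ls where ls: "ks = map (\<lambda>l. l \<cdot>\<^sub>m 1\<^sub>m n) ls" using ex_map by metis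
    have "set ls \<subseteq> {0}" using ks ls by (intro mat_indep) (auto simp: ring_mat_simps)
    then show "set ks \<subseteq> {\<zero>\<^bsub>?M\<^esub>}" by (auto simp: ls ring_mat_simps intro!: eq_matI)
  next
    fix X assume "X \<in> carrier ?M"
    then have X: "X \<in> carrier_mat n n" by (simp add: ring_mat_simps)
    show "\<exists>ks. set ks \<subseteq> range (\<lambda>l. l \<cdot>\<^sub>m 1\<^sub>m n) \<and> mat_combine ks basis_mats = X"
      using mat_span[OF X] by (intro exI conjI) auto
  qed
  ultimately show ?thesis
    unfolding splitting_def using Psi.homh Psi_center_fract by blast
qed

end

section \<open>Independence of the splitting\<close>

locale skew_matrix_rep = cyclic_ext_dual \<iota> n \<sigma> b c
  for \<iota> :: "'f::field \<Rightarrow> 'k::field" and n :: nat and \<sigma> :: "'k \<Rightarrow> 'k" and b c :: "nat \<Rightarrow> 'k" +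
  fixes \<rho> :: "'k poly \<Rightarrow> 'k poly fract mat"
  assumes \<rho>_carrier [simp]: "\<rho> f \<in> carrier_mat n n"
    and \<rho>_mult: "\<rho> (skew_mult \<sigma> f g) = \<rho> f * \<rho> g"
    and \<rho>_add: "\<rho> (f + g) = \<rho> f + \<rho> g"
    and \<rho>_center: "\<rho> (center_poly \<iota> n q) = to_fract (map_poly \<iota> q) \<cdot>\<^sub>m 1\<^sub>m n"
begin

lemma \<rho>_dim [simp]: "dim_row (\<rho> f) = n" "dim_col (\<rho> f) = n"
  by (rule carrier_matD[OF \<rho>_carrier])+

lemma \<rho>_0: "\<rho> 0 = 0\<^sub>m n n"
  using \<rho>_center[of 0] by (auto simp: center_poly_def intro: eq_matI)

lemma \<rho>_1: "\<rho> 1 = 1\<^sub>m n"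
  using \<rho>_center[of 1] by (auto simp: center_poly_1 intro: eq_matI)

lemma \<rho>_scale:
  assumes "i < n" "j < n"
  shows "\<rho> [:\<iota> r * a:] $$ (i, j) = const_fract (\<iota> r) * \<rho> [:a:] $$ (i, j)"
proof -
  have "[:\<iota> r * a:] = skew_mult \<sigma> (center_poly \<iota> n [:r:]) [:a:]"
    using skew_mult_monom[of "\<iota> r" 0 a 0] by (simp add: center_poly_def \<iota>.map_poly_pCons_hom monom_0)
  then have "\<rho> [:\<iota> r * a:] = const_fract (\<iota> r) \<cdot>\<^sub>m \<rho> [:a:]"
    by (simp add: \<rho>_mult \<rho>_center \<iota>.map_poly_pCons_hom const_fract_def mult_smult_assoc_mat[of _ n n _ n]
        left_mult_one_mat[of _ n n])
  then show ?thesis using assms by simp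
qed

lemma \<rho>_sum:
  assumes "finite A" "i < n" "j < n"
  shows "\<rho> (\<Sum>x\<in>A. f x) $$ (i, j) = (\<Sum>x\<in>A. \<rho> (f x) $$ (i, j))"
  using assms(1) by induction (simp_all add: assms(2,3) \<rho>_0 \<rho>_add)

lemma trace_expand: "(\<Sum>j<n. trace (c j * a) * b j) = a"
proof -
  have "(\<Sum>j<n. trace (c j * a) * b j) = (\<Sum>k<n. (\<sigma> ^^ k) a * (\<Sum>j<n. (\<sigma> ^^ k) (c j) * (\<sigma> ^^ 0) (b j)))"
    unfolding trace_def sum_distrib_left sum_distrib_right
    by (subst sum.swap) (simp add: funpow.hom_mult mult_ac)
  also have "\<dots> = (\<Sum>k<n. if k = 0 then a else 0)"
    using n_pos by (intro sum.cong refl, subst sum_conj) auto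
  also have "\<dots> = a" using n_pos by simp
  finally show ?thesis .
qed

text \<open>The coordinates Tr(c_k a) of a in the basis \<open>b\<close> lie in F and therefore pass
  through \<rho> as scalars.\<close>

lemma \<rho>_const:
  assumes "i < n" "j < n"
  shows "\<rho> [:a:] $$ (i, j) = (\<Sum>k<n. const_fract (trace (c k * a)) * \<rho> [:b k:] $$ (i, j))"
proof -
  have "[:\<Sum>k<m. g k:] = (\<Sum>k<m. [:g k:])" for g :: "nat \<Rightarrow> 'k" and m
  proof (induction m)
    case (Suc m)
    have "[:(\<Sum>k<m. g k) + g m:] = [:\<Sum>k<m. g k:] + [:g m:]" by simp
    with Suc show ?case by (simp del: add_pCons)
  qed simp
  then have "[:a:] = (\<Sum>k<n. [:trace (c k * a) * b k:])"
    using trace_expand[of a] by metis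
  then have "\<rho> [:a:] $$ (i, j) = (\<Sum>k<n. \<rho> [:trace (c k * a) * b k:] $$ (i, j))"
    using assms by (simp add: \<rho>_sum)
  also have "\<dots> = (\<Sum>k<n. const_fract (trace (c k * a)) * \<rho> [:b k:] $$ (i, j))"
  proof (intro sum.cong refl)
    fix k
    obtain r where "trace (c k * a) = \<iota> r" using trace_in_range by blast
    then show "\<rho> [:trace (c k * a) * b k:] $$ (i, j) = const_fract (trace (c k * a)) * \<rho> [:b k:] $$ (i, j)"
      using assms by (simp add: \<rho>_scale)
  qed
  finally show ?thesis .
qed

text \<open>The image of the idempotent of \<open>K \<otimes> K\<close> that projects onto the \<open>\<sigma>\<^sup>k\<close>-eigenspace of \<open>K\<close>.\<close>

definition proj :: "nat \<Rightarrow> 'k poly fract mat" where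
  "proj k = mat n n (\<lambda>(r, s). \<Sum>j<n. const_fract ((\<sigma> ^^ k) (c j)) * \<rho> [:b j:] $$ (r, s))"

lemma proj_carrier [simp]: "proj k \<in> carrier_mat n n" "dim_row (proj k) = n" "dim_col (proj k) = n"
  by (simp_all add: proj_def)

text \<open>Summing \<sigma>^k(c_j) over k gives Tr(c_j), the j-th coordinate of 1.\<close>

lemma sum_proj:
  assumes "r < n" "s < n"
  shows "(\<Sum>k<n. proj k $$ (r, s)) = 1\<^sub>m n $$ (r, s)"
proof -
  have "(\<Sum>k<n. proj k $$ (r, s))
      = (\<Sum>k<n. \<Sum>j<n. const_fract ((\<sigma> ^^ k) (c j)) * \<rho> [:b j:] $$ (r, s))"
    using assms by (simp add: proj_def)
  also have "\<dots> = (\<Sum>j<n. const_fract (trace (c j * 1)) * \<rho> [:b j:] $$ (r, s))"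
    by (subst sum.swap) (simp add: trace_def const_fract.hom_sum sum_distrib_right)
  also have "\<dots> = \<rho> [:1:] $$ (r, s)" using assms by (rule \<rho>_const[symmetric])
  finally show ?thesis by (simp add: pCons_one \<rho>_1)
qed

text \<open>Every row of \<open>proj k\<close> is an eigenvector on which K acts through \<sigma>^k.
  Expanding b_j a again in the basis \<open>b\<close> and applying \<open>sum_conj\<close> leaves
  only the conjugate with exponent k.\<close>

lemma proj_const:
  assumes k: "k < n"
  shows "proj k * \<rho> [:a:] = const_fract ((\<sigma> ^^ k) a) \<cdot>\<^sub>m proj k"
proof (rule eq_matI)
  fix r s assume "r < dim_row (const_fract ((\<sigma> ^^ k) a) \<cdot>\<^sub>m proj k)"
    "s < dim_col (const_fract ((\<sigma> ^^ k) a) \<cdot>\<^sub>m proj k)"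
  then have r: "r < n" and s: "s < n" by auto
  let ?\<kappa> = const_fract
  have coeff: "(\<Sum>j<n. (\<sigma> ^^ k) (c j) * trace (c j' * (b j * a))) = (\<sigma> ^^ k) (a * c j')" for j'
  proof -
    have "(\<Sum>j<n. (\<sigma> ^^ k) (c j) * trace (c j' * (b j * a)))
        = (\<Sum>l<n. (\<sigma> ^^ l) (a * c j') * (\<Sum>j<n. (\<sigma> ^^ k) (c j) * (\<sigma> ^^ l) (b j)))"
      unfolding trace_def sum_distrib_left by (subst sum.swap) (simp add: funpow.hom_mult mult_ac)
    also have "\<dots> = (\<Sum>l<n. if k = l then (\<sigma> ^^ l) (a * c j') else 0)"
      using k by (intro sum.cong refl) (simp add: sum_conj)
    also have "\<dots> = (\<sigma> ^^ k) (a * c j')" using k by simp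
    finally show ?thesis .
  qed
  have b_a: "\<rho> [:b j * a:] = \<rho> [:b j:] * \<rho> [:a:]" for j
    using skew_mult_monom[of "b j" 0 a 0] by (simp add: monom_0 flip: \<rho>_mult)
  have "(proj k * \<rho> [:a:]) $$ (r, s)
      = (\<Sum>m<n. (\<Sum>j<n. ?\<kappa> ((\<sigma> ^^ k) (c j)) * \<rho> [:b j:] $$ (r, m)) * \<rho> [:a:] $$ (m, s))"
    using r s by (simp add: proj_def scalar_prod_def atLeast0LessThan)
  also have "\<dots> = (\<Sum>j<n. ?\<kappa> ((\<sigma> ^^ k) (c j)) * \<rho> [:b j * a:] $$ (r, s))"
    using r s unfolding b_a sum_distrib_right
    by (subst sum.swap) (simp add: scalar_prod_def atLeast0LessThan sum_distrib_left mult.assoc)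
  also have "\<dots> = (\<Sum>j<n. ?\<kappa> ((\<sigma> ^^ k) (c j)) *
      (\<Sum>j'<n. ?\<kappa> (trace (c j' * (b j * a))) * \<rho> [:b j':] $$ (r, s)))"
    using r s by (intro sum.cong refl, subst \<rho>_const) auto
  also have "\<dots> = (\<Sum>j'<n. ?\<kappa> (\<Sum>j<n. (\<sigma> ^^ k) (c j) * trace (c j' * (b j * a))) * \<rho> [:b j':] $$ (r, s))"
    unfolding sum_distrib_left const_fract.hom_sum sum_distrib_right
    by (subst sum.swap) (simp add: const_fract.hom_mult mult.assoc)
  also have "\<dots> = (const_fract ((\<sigma> ^^ k) a) \<cdot>\<^sub>m proj k) $$ (r, s)"
    unfolding coeff using r s
    by (simp add: proj_def funpow.hom_mult const_fract.hom_mult sum_distrib_left mult.assoc)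
  finally show "(proj k * \<rho> [:a:]) $$ (r, s) = (const_fract ((\<sigma> ^^ k) a) \<cdot>\<^sub>m proj k) $$ (r, s)" .
qed auto

lemma \<rho>_monom_x: "\<rho> (monom 1 (m + n * q)) = to_fract (monom 1 q) \<cdot>\<^sub>m \<rho> (monom 1 m)"
proof -
  have "monom 1 (m + n * q) = skew_mult \<sigma> (monom 1 m) (center_poly \<iota> n (monom 1 q))"
  proof -
    have "center_poly \<iota> n (monom 1 q) = monom 1 (n * q)"
      using n_pos by (intro poly_eqI) (auto simp: coeff_center_poly, metis dvd_triv_left)
    then show ?thesis by (simp add: skew_mult_monom)
  qed
  then show ?thesis
    by (simp add: \<rho>_mult \<rho>_center map_poly_monom mult_smult_distrib[of _ n n _ n] right_mult_one_mat[of _ n n])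
qed

theorem det_\<rho>: "det (\<rho> f) = to_fract (det (rep f))"
proof -
  \<comment> \<open>The (0, 0) entries add up to 1, so the first row of some \<open>proj k\<close>
    is a nonzero eigenvector, though with an unspecified character \<sigma>^k.\<close>
  have "\<exists>k<n. proj k $$ (0, 0) \<noteq> 0"
  proof (rule ccontr)
    assume "\<not> (\<exists>k<n. proj k $$ (0, 0) \<noteq> 0)"
    then have "(\<Sum>k<n. proj k $$ (0, 0)) = 0" by simp
    then show False using sum_proj[of 0 0] n_pos by simp
  qed
  then obtain k where k: "k < n" and nz: "proj k $$ (0, 0) \<noteq> 0" by blast
  \<comment> \<open>Multiplication by t^(n-k) changes the character \<sigma>^k into \<sigma>^n, the
    identity; n - k stands for -k. The rows of \<open>V i\<close> then have character
    \<sigma>^i.\<close>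
  define V where "V i = proj k * \<rho> (monom 1 (n - k + i))" for i
  have V_carrier [simp]: "V i \<in> carrier_mat n n" "dim_row (V i) = n" "dim_col (V i) = n" for i
    by (simp_all add: V_def mult_carrier_mat[of _ n n _ n])
  have V_monom: "V i * \<rho> (monom a m) = const_fract ((\<sigma> ^^ i) a) \<cdot>\<^sub>m V (i + m)" for i a m
  proof -
    have pow: "(\<sigma> ^^ k) ((\<sigma> ^^ (n - k + i)) a) = (\<sigma> ^^ i) a"
    proof -
      have "\<sigma> ^^ (k + (n - k + i)) = \<sigma> ^^ i" using k by (simp add: funpow_add pow_n)
      then show ?thesis by (metis comp_apply funpow_add)
    qed
    have "V i * \<rho> (monom a m) = proj k * \<rho> (skew_mult \<sigma> (monom 1 (n - k + i)) (monom a m))"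
      by (simp add: V_def \<rho>_mult assoc_mult_mat[of _ n n _ n _ n])
    also have "skew_mult \<sigma> (monom 1 (n - k + i)) (monom a m)
        = skew_mult \<sigma> [:(\<sigma> ^^ (n - k + i)) a:] (monom 1 (n - k + (i + m)))"
      using skew_mult_monom[of "(\<sigma> ^^ (n - k + i)) a" 0 1 "n - k + (i + m)"]
      by (simp add: skew_mult_monom monom_0 add.assoc)
    also have "proj k * \<rho> \<dots> = (proj k * \<rho> [:(\<sigma> ^^ (n - k + i)) a:]) * \<rho> (monom 1 (n - k + (i + m)))"
      by (simp add: \<rho>_mult assoc_mult_mat[of _ n n _ n _ n])
    also have "\<dots> = const_fract ((\<sigma> ^^ i) a) \<cdot>\<^sub>m V (i + m)"
      unfolding proj_const[OF k] pow by (simp add: V_def mult_smult_assoc_mat[of _ n n _ n])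
    finally show ?thesis .
  qed
  have V_x: "V (i + n * q) = to_fract (monom 1 q) \<cdot>\<^sub>m V i" for i q
    unfolding V_def add.assoc[symmetric] \<rho>_monom_x by (simp add: mult_smult_distrib[of _ n n _ n])
  define P where "P = mat n n (\<lambda>(i, s). V i $$ (0, s))"
  have P [simp]: "P \<in> carrier_mat n n" "dim_row P = n" "dim_col P = n" by (simp_all add: P_def)
  have P_\<rho>: "(P * \<rho> g) $$ (i, s) = (V i * \<rho> g) $$ (0, s)" if "i < n" "s < n" for g i s
    using that n_pos by (simp add: P_def scalar_prod_def)
  have intertwine: "P * \<rho> f = rep_fract f * P" for f
  proof -
    have monom: "P * \<rho> (monom a m) = rep_fract (monom a m) * P" for a m
    proof (rule eq_matI)
      fix i s assume "i < dim_row (rep_fract (monom a m) * P)" "s < dim_col (rep_fract (monom a m) * P)"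
      then have i: "i < n" and s: "s < n" by auto
      have "(rep_fract (monom a m) * P) $$ (i, s) = (\<Sum>j<n. rep_fract (monom a m) $$ (i, j) * V j $$ (0, s))"
        using i s by (simp add: P_def scalar_prod_def atLeast0LessThan)
      also have "\<dots> = (\<Sum>j<n. if j = (m + i) mod n then
          const_fract ((\<sigma> ^^ i) a) * (to_fract (monom 1 ((m + i) div n)) * V ((m + i) mod n) $$ (0, s)) else 0)"
        using i by (intro sum.cong refl) (auto simp: rep_fract_monom)
      also have "\<dots> = const_fract ((\<sigma> ^^ i) a) *
          (to_fract (monom 1 ((m + i) div n)) \<cdot>\<^sub>m V ((m + i) mod n)) $$ (0, s)"
        using n_pos s by simp
      also have "to_fract (monom 1 ((m + i) div n)) \<cdot>\<^sub>m V ((m + i) mod n) = V (i + m)"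
        by (simp add: add.commute flip: V_x)
      also have "const_fract ((\<sigma> ^^ i) a) * V (i + m) $$ (0, s) = (P * \<rho> (monom a m)) $$ (i, s)"
        unfolding P_\<rho>[OF i s] V_monom using s n_pos by simp
      finally show "(P * \<rho> (monom a m)) $$ (i, s) = (rep_fract (monom a m) * P) $$ (i, s)" ..
    qed auto
    have "P * \<rho> (\<Sum>m\<in>A. monom (coeff f m) m) = rep_fract (\<Sum>m\<in>A. monom (coeff f m) m) * P"
      if "finite A" for A
      using that
    proof induction
      case empty
      then show ?case by (simp add: \<rho>_0 rep_fract_0 right_mult_zero_mat[of _ n n] left_mult_zero_mat[of _ n n])
    next
      case (insert m A)
      then show ?case
        by (simp add: \<rho>_add rep_fract_add monom mult_add_distrib_mat[of _ n n _ n] add_mult_distrib_mat[of _ n n _ _ n])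
    qed
    from this[of "{..degree f}"] show ?thesis by (simp add: poly_as_sum_of_monoms)
  qed
  have P_row: "\<exists>s<n. P $$ (l, s) \<noteq> 0" if l: "l < n" for l
  proof (rule ccontr)
    assume "\<not> (\<exists>s<n. P $$ (l, s) \<noteq> 0)"
    then have z: "V l $$ (0, s) = 0" if "s < n" for s using that l by (simp add: P_def)
    \<comment> \<open>The exponents add up to 2 n, so a vanishing row l would make x^2 times the
      first row of \<open>proj k\<close> vanish. The extra n keeps n + k - l from
      truncating.\<close>
    have "(V l * \<rho> (monom 1 (n + k - l))) $$ (0, 0) = 0"
      using n_pos z by (simp add: scalar_prod_def)
    then have "V (l + (n + k - l)) $$ (0, 0) = 0" using n_pos by (simp add: V_monom)
    moreover have "V (l + (n + k - l)) = to_fract (monom 1 2) \<cdot>\<^sub>m (proj k * \<rho> (monom 1 0))"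
    proof -
      have "n - k + (l + (n + k - l)) = 0 + n * 2" using k l by simp
      then have "V (l + (n + k - l)) = proj k * \<rho> (monom 1 (0 + n * 2))" by (simp only: V_def)
      then show ?thesis unfolding \<rho>_monom_x by (simp add: mult_smult_distrib[of _ n n _ n])
    qed
    ultimately show False
      using nz n_pos by (simp add: monom_0 pCons_one \<rho>_1 right_mult_one_mat[of _ n n])
  qed
  have "det P \<noteq> 0"
  proof
    assume "det P = 0"
    then have "det (transpose_mat P) = 0" by (simp add: det_transpose[of _ n])
    then obtain w where w: "w \<in> carrier_vec n" "w \<noteq> 0\<^sub>v n" "transpose_mat P *\<^sub>v w = 0\<^sub>v n"
      using det_0_iff_vec_prod_zero_field[of "transpose_mat P" n] by auto
    have wP: "(\<Sum>i<n. w $ i * P $$ (i, s)) = 0" if "s < n" for s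
    proof -
      have "(transpose_mat P *\<^sub>v w) $ s = (\<Sum>i<n. w $ i * P $$ (i, s))"
        using that w(1) by (simp add: scalar_prod_def atLeast0LessThan mult.commute)
      then show ?thesis using w(3) that by simp
    qed
    \<comment> \<open>Multiplying the relation by \<rho>(a) scales row i by \<sigma>^i(a), which
      turns one relation into a family indexed by a.\<close>
    have w_conj: "(\<Sum>i<n. w $ i * (const_fract ((\<sigma> ^^ i) a) * P $$ (i, s))) = 0" if s: "s < n" for a s
    proof -
      have "(P * \<rho> [:a:]) $$ (i, s) = const_fract ((\<sigma> ^^ i) a) * P $$ (i, s)" if "i < n" for i
        unfolding P_\<rho>[OF that s] monom_0[symmetric] V_monom using that s n_pos by (simp add: P_def)
      then have "(\<Sum>i<n. w $ i * (const_fract ((\<sigma> ^^ i) a) * P $$ (i, s)))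
          = (\<Sum>i<n. w $ i * (\<Sum>m<n. P $$ (i, m) * \<rho> [:a:] $$ (m, s)))"
        using s by (intro sum.cong refl) (simp add: scalar_prod_def atLeast0LessThan)
      also have "\<dots> = (\<Sum>m<n. (\<Sum>i<n. w $ i * P $$ (i, m)) * \<rho> [:a:] $$ (m, s))"
        unfolding sum_distrib_left sum_distrib_right by (subst sum.swap) (simp add: mult.assoc)
      also have "\<dots> = 0" by (simp add: wP)
      finally show ?thesis .
    qed
    \<comment> \<open>Taking a = b_j with weights \<sigma>^l(c_j) and summing over j isolates row l:
      independence of eigenvectors with distinct characters.\<close>
    have "w $ l * P $$ (l, s) = 0" if l: "l < n" and s: "s < n" for l s
    proof -
      have "w $ l * P $$ (l, s) = (\<Sum>i<n. if i = l then w $ i * P $$ (i, s) else 0)" using l by simp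
      also have "\<dots> = (\<Sum>i<n. w $ i * P $$ (i, s) * const_fract (\<Sum>j<n. (\<sigma> ^^ l) (c j) * (\<sigma> ^^ i) (b j)))"
        using l by (intro sum.cong refl) (simp add: sum_conj)
      also have "\<dots> = (\<Sum>j<n. const_fract ((\<sigma> ^^ l) (c j)) *
          (\<Sum>i<n. w $ i * (const_fract ((\<sigma> ^^ i) (b j)) * P $$ (i, s))))"
        unfolding const_fract.hom_sum const_fract.hom_mult sum_distrib_left by (subst sum.swap) (simp add: mult_ac)
      also have "\<dots> = 0" using s by (simp add: w_conj)
      finally show ?thesis .
    qed
    with P_row have "w $ l = 0" if "l < n" for l using that by fastforce
    then have "w = 0\<^sub>v n" using w(1) by (intro eq_vecI) auto
    with w(2) show False by contradiction
  qed
  moreover have "det P * det (\<rho> f) = det (rep_fract f) * det P"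
    using arg_cong[OF intertwine, of det] by (simp add: det_mult[of _ n])
  ultimately show ?thesis by (simp add: det_rep_fract)
qed

end

section \<open>The reduced norm as a determinant\<close>

context cyclic_ext_dual
begin

lemma det_splitting:
  assumes "splitting (skew_quot_ring \<iota> n \<sigma>) (center_fract \<iota> n \<sigma>) (map_ratfun \<iota>) n \<phi>"
  shows "det (\<phi> (skew_quot \<iota> n \<sigma> f 1)) = to_fract (det (rep f))"
proof -
  have hom: "\<phi> \<in> Ring.ring_hom (skew_quot_ring \<iota> n \<sigma>) (ring_mat TYPE('k poly fract) n ())"
    and center: "\<phi> (center_fract \<iota> n \<sigma> d) = map_ratfun \<iota> d \<cdot>\<^sub>m 1\<^sub>m n" for d
    using assms by (simp_all add: splitting_def)
  have carrier: "skew_quot \<iota> n \<sigma> f 1 \<in> carrier (skew_quot_ring \<iota> n \<sigma>)" for f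
    by (intro Q.quot_carrier one_in_denoms UNIV_I)
  have skew_mult_1: "skew_mult \<sigma> f 1 = f" for f
    unfolding rep_inj[symmetric] rep_mult rep_1 by (simp add: right_mult_one_mat[of _ n n])
  interpret skew_matrix_rep \<iota> n \<sigma> b c "\<lambda>f. \<phi> (skew_quot \<iota> n \<sigma> f 1)"
  proof
    fix f g
    show "\<phi> (skew_quot \<iota> n \<sigma> f 1) \<in> carrier_mat n n"
      using ring_hom_closed[OF hom carrier] by (simp add: ring_mat_simps)
    show "\<phi> (skew_quot \<iota> n \<sigma> (skew_mult \<sigma> f g) 1) = \<phi> (skew_quot \<iota> n \<sigma> f 1) * \<phi> (skew_quot \<iota> n \<sigma> g 1)"
      using ring_hom_mult[OF hom carrier carrier, of f g]
      by (simp add: Q.quot_mult one_in_denoms skew_mult_1 ring_mat_simps)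
    show "\<phi> (skew_quot \<iota> n \<sigma> (f + g) 1) = \<phi> (skew_quot \<iota> n \<sigma> f 1) + \<phi> (skew_quot \<iota> n \<sigma> g 1)"
      using ring_hom_add[OF hom carrier carrier, of f g]
      by (simp add: Q.quot_add one_in_denoms skew_mult_1 ring_mat_simps)
  next
    fix q
    have "center_fract \<iota> n \<sigma> (to_fract q) = skew_quot \<iota> n \<sigma> (center_poly \<iota> n q) 1"
      using center_fract_Fract[of 1 q] by (simp add: to_fract_def center_poly_1)
    then show "\<phi> (skew_quot \<iota> n \<sigma> (center_poly \<iota> n q) 1) = to_fract (map_poly \<iota> q) \<cdot>\<^sub>m 1\<^sub>m n"
      using center[of "to_fract q"] by (simp add: map_ratfun_to_fract)
  qed
  show ?thesis by (rule det_\<rho>)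
qed

text \<open>\<open>splitting_Psi\<close> provides existence for the definite description; uniqueness
  follows from \<open>det_splitting\<close> and injectivity of the embedding of F(x) into
  K(x).\<close>

theorem skew_norm_eq:
  assumes "det (rep f) = map_poly \<iota> q"
  shows "skew_norm \<iota> n \<sigma> (skew_quot \<iota> n \<sigma> f 1) = to_fract q"
  unfolding skew_norm_def reduced_norm_def
proof (rule the_equality)
  have eq: "to_fract (det (rep f)) = map_ratfun \<iota> (to_fract q)"
    by (simp add: assms map_ratfun_to_fract)
  show "\<exists>\<phi>. splitting (skew_quot_ring \<iota> n \<sigma>) (center_fract \<iota> n \<sigma>) (map_ratfun \<iota>) n \<phi> \<and>
      det (\<phi> (skew_quot \<iota> n \<sigma> f 1)) = map_ratfun \<iota> (to_fract q)"
    using splitting_Psi det_splitting[OF splitting_Psi] eq by metis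
  fix d assume "\<exists>\<phi>. splitting (skew_quot_ring \<iota> n \<sigma>) (center_fract \<iota> n \<sigma>) (map_ratfun \<iota>) n \<phi> \<and>
      det (\<phi> (skew_quot \<iota> n \<sigma> f 1)) = map_ratfun \<iota> d"
  then have "map_ratfun \<iota> d = map_ratfun \<iota> (to_fract q)"
    using det_splitting eq by metis
  then show "d = to_fract q" by simp
qed

end

theorem lemma5:
  fixes \<iota> :: "'f::field \<Rightarrow> 'k::field"
    and n :: nat
    and \<sigma> :: "'k \<Rightarrow> 'k"
    and f :: "'k poly"
    and p :: "'f poly"
  assumes "cyclic_galois \<iota> n \<sigma>"
    and "skew_norm \<iota> n \<sigma> (skew_quot \<iota> n \<sigma> f 1) = to_fract p"
    and "irreducible p"
  shows "skew_irreducible \<sigma> f"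
proof -
  interpret cyclic_ext \<iota> n \<sigma> by (rule cyclic_ext.intro) (rule assms(1))
  obtain b c where "cyclic_ext_dual \<iota> n \<sigma> b c"
    using dual_bases(2) cyclic_ext_axioms
    by (auto simp: cyclic_ext_dual_def cyclic_ext_dual_axioms_def)
  then interpret cyclic_ext_dual \<iota> n \<sigma> b c .
  have det_mult_rep: "det (rep (skew_mult \<sigma> g h)) = det (rep g) * det (rep h)" for g h
    by (simp add: rep_mult det_mult[of _ n])
  \<comment> \<open>The norm is given as an element of F(x); injectivity of \<open>to_fract\<close>
    turns it into a determinant over K[x].\<close>
  obtain q where "det (rep f) = map_poly \<iota> q" using det_rep_in_center by blast
  with skew_norm_eq[OF this] assms(2) have det_f: "det (rep f) = map_poly \<iota> p" by simp
  have not_unit: "f \<notin> Units (skew_ring \<sigma>)"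
  proof
    assume "f \<in> Units (skew_ring \<sigma>)"
    then obtain g where "skew_mult \<sigma> f g = 1" by (auto simp: Units_def skew_ring_def)
    then have "det (rep f) * det (rep g) = 1" by (simp add: rep_1 flip: det_mult_rep)
    moreover obtain q where "det (rep g) = map_poly \<iota> q" using det_rep_in_center by blast
    ultimately have "map_poly \<iota> (p * q) = map_poly \<iota> 1" by (simp add: det_f map_\<iota>.hom_mult)
    then have "p * q = 1" by (simp only: map_\<iota>.eq_iff)
    then show False using assms(3) by (metis dvd_triv_left irreducible_not_unit)
  qed
  have degree_0: "degree g = 0 \<or> degree h = 0" if f: "f = skew_mult \<sigma> g h" for g h
  proof -
    obtain q r where q: "det (rep g) = map_poly \<iota> q" and r: "det (rep h) = map_poly \<iota> r"
      using det_rep_in_center by meson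
    have "map_poly \<iota> p = map_poly \<iota> (q * r)"
      using det_f by (simp add: f det_mult_rep q r map_\<iota>.hom_mult)
    then have "p = q * r" by (simp only: map_\<iota>.eq_iff)
    then have "q dvd 1 \<or> r dvd 1" by (rule irreducibleD[OF assms(3)])
    \<comment> \<open>A unit of F[x] remains a unit in K[x], where the determinants live.\<close>
    then have "det (rep g) dvd 1 \<or> det (rep h) dvd 1"
      unfolding q r using map_\<iota>.hom_dvd_1 by blast
    then show ?thesis by (rule disj_forward) (erule degree_0_if_det_rep_unit)+
  qed
  show ?thesis
    unfolding skew_irreducible_def
  proof (intro conjI notI)
    show "f \<in> Units (skew_ring \<sigma>) \<Longrightarrow> False" using not_unit by contradiction
    assume "\<exists>g h. f = skew_mult \<sigma> g h \<and> 1 \<le> degree g \<and> degree g < degree f \<and>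
      1 \<le> degree h \<and> degree h < degree f"
    then obtain g h where "f = skew_mult \<sigma> g h" "1 \<le> degree g" "1 \<le> degree h" by (elim exE conjE)
    with degree_0[OF this(1)] show False by (elim disjE) simp_all
  qed
qed

end
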